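(* There is a constant $c$ such that for every $f\in L^1(W^T_\kappa;T^d)$ and every $x\in T^d$, $\mathcal M^T_\kappa f(x)\le c\,M^T_\kappa f(x)$.
   Context: $T^d=\{x\in\mathbb R^d:x_i\ge0,\ |x|:=x_1+\dots+x_d\le1\}$, $B^d$ the unit ball of $\mathbb R^d$, $\psi(x)=(x_1^2,\dots,x_d^2)$ mapping $B^d$ onto $T^d$. $\kappa=(\kappa_1,\dots,\kappa_{d+1})$, $\kappa_i\ge0$; $W^T_\kappa(x)=\prod_{i=1}^dx_i^{\kappa_i-1/2}(1-|x|)^{\kappa_{d+1}-1/2}$ on $T^d$; $W^B_\kappa(x)=\prod_{i=1}^d|x_i|^{2\kappa_i}(1-\|x\|^2)^{\kappa_{d+1}-1/2}$ on $B^d$. $V_\kappa g(z)=c_\kappa\int_{[-1,1]^{d+1}}g(z_1t_1,\dots,z_{d+1}t_{d+1})\prod_{i=1}^{d+1}(1+t_i)(1-t_i^2)^{\kappa_i-1}dt$ on functions on $\mathbb R^{d+1}$, $V_\kappa1=1$ (factors with $\kappa_i=0$ via the limit $\frac12[g(1)+g(-1)]$); $V^B_\kappa g(x,x_{d+1})=\frac12[V_\kappa g(x,x_{d+1})+V_\kappa g(x,-x_{d+1})]$; $e(x,\theta)=\{(y,y_{d+1}):\|(y,y_{d+1})\|\le1,\ \langle x,y\rangle+\sqrt{1-\|x\|^2}y_{d+1}\ge\cos\theta,\ y_{d+1}\ge0\}$; $Y=(y,\sqrt{1-\|y\|^2})$; $\mathcal M^B_\kappa g(x)=\sup_{0<\theta\le\pi}\frac{\int_{B^d}|g(y)|V^B_\kappa[\chi_{e(x,\theta)}](Y)W^B_\kappa(y)dy}{\int_{B^d}V^B_\kappa[\chi_{e(x,\theta)}](Y)W^B_\kappa(y)dy}$.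 $\mathcal M^T_\kappa$ is characterized by $(\mathcal M^T_\kappa f)\circ\psi=\mathcal M^B_\kappa(f\circ\psi)$. With $d_T(x,y)=\arccos\big(\sum_{i=1}^d\sqrt{x_iy_i}+\sqrt{1-|x|}\sqrt{1-|y|}\big)$, $M^T_\kappa f(x)=\sup_{0<\theta\le\pi}\frac{\int_{d_T(x,y)\le\theta}|f(y)|W^T_\kappa(y)dy}{\int_{d_T(x,y)\le\theta}W^T_\kappa(y)dy}$. *)

theory Defs
  imports "HOL-Probability.Probability"
begin

text \<open>Points of R^d are functions nat => real, extensional on {..<d} (as in PiM);
  points of R^(d+1) are extensional on {..d}, the last coordinate having index d.
  kappa is indexed 0..d, kappa d playing the role of kappa_(d+1).\<close>

definition lebd :: "nat \<Rightarrow> (nat \<Rightarrow> real) measure" where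
  "lebd d = (\<Pi>\<^sub>M i\<in>{..<d}. lborel)"

definition simplexT :: "nat \<Rightarrow> (nat \<Rightarrow> real) set" where
  "simplexT d = {x \<in> PiE {..<d} (\<lambda>_. UNIV). (\<forall>i<d. 0 \<le> x i) \<and> (\<Sum>i<d. x i) \<le> 1}"

definition ballB :: "nat \<Rightarrow> (nat \<Rightarrow> real) set" where
  "ballB d = {x \<in> PiE {..<d} (\<lambda>_. UNIV). (\<Sum>i<d. (x i)^2) \<le> 1}"

definition psi :: "nat \<Rightarrow> (nat \<Rightarrow> real) \<Rightarrow> (nat \<Rightarrow> real)" where
  "psi d y = restrict (\<lambda>i. (y i)^2) {..<d}"

definition WT :: "(nat \<Rightarrow> real) \<Rightarrow> nat \<Rightarrow> (nat \<Rightarrow> real) \<Rightarrow> real" where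
  "WT \<kappa> d x = (\<Prod>i<d. x i powr (\<kappa> i - 1/2)) * (1 - (\<Sum>i<d. x i)) powr (\<kappa> d - 1/2)"

definition WB :: "(nat \<Rightarrow> real) \<Rightarrow> nat \<Rightarrow> (nat \<Rightarrow> real) \<Rightarrow> real" where
  "WB \<kappa> d x = (\<Prod>i<d. \<bar>x i\<bar> powr (2 * \<kappa> i)) * (1 - (\<Sum>i<d. (x i)^2)) powr (\<kappa> d - 1/2)"

definition dT :: "nat \<Rightarrow> (nat \<Rightarrow> real) \<Rightarrow> (nat \<Rightarrow> real) \<Rightarrow> real" where
  "dT d x y = arccos ((\<Sum>i<d. sqrt (x i * y i)) + sqrt (1 - (\<Sum>i<d. x i)) * sqrt (1 - (\<Sum>i<d. y i)))"

text \<open>One-dimensional factor of the measure defining V_kappa: normalized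
  c (1+t)(1-t^2)^(k-1) dt on [-1,1] for k > 0, and (delta_1 + delta_(-1))/2 for k = 0.\<close>
definition kmeas :: "real \<Rightarrow> real measure" where
  "kmeas k = (if k = 0 then distr (measure_pmf (pmf_of_set {-1, 1})) borel (\<lambda>t. t)
     else density lborel (\<lambda>t. ennreal (indicator {-1..1} t * (1 + t) * (1 - t^2) powr (k - 1)
        / (\<integral>s. indicator {-1..1} s * (1 + s) * (1 - s^2) powr (k - 1) \<partial>lborel))))"

definition Vk :: "(nat \<Rightarrow> real) \<Rightarrow> nat \<Rightarrow> ((nat \<Rightarrow> real) \<Rightarrow> real) \<Rightarrow> (nat \<Rightarrow> real) \<Rightarrow> real" where
  "Vk \<kappa> d g z = (\<integral>t. g (restrict (\<lambda>i. z i * t i) {..d}) \<partial>(\<Pi>\<^sub>M i\<in>{..d}. kmeas (\<kappa> i)))"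

definition VkB :: "(nat \<Rightarrow> real) \<Rightarrow> nat \<Rightarrow> ((nat \<Rightarrow> real) \<Rightarrow> real) \<Rightarrow> (nat \<Rightarrow> real) \<Rightarrow> real" where
  "VkB \<kappa> d g z = (Vk \<kappa> d g z + Vk \<kappa> d g (z(d := - z d))) / 2"

definition liftY :: "nat \<Rightarrow> (nat \<Rightarrow> real) \<Rightarrow> (nat \<Rightarrow> real)" where
  "liftY d y = y(d := sqrt (1 - (\<Sum>i<d. (y i)^2)))"

definition capE :: "nat \<Rightarrow> (nat \<Rightarrow> real) \<Rightarrow> real \<Rightarrow> (nat \<Rightarrow> real) set" where
  "capE d x \<theta> = {w \<in> PiE {..d} (\<lambda>_. UNIV). (\<Sum>i\<le>d. (w i)^2) \<le> 1 \<and>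
      cos \<theta> \<le> (\<Sum>i<d. x i * w i) + sqrt (1 - (\<Sum>i<d. (x i)^2)) * w d \<and> 0 \<le> w d}"

definition MB :: "(nat \<Rightarrow> real) \<Rightarrow> nat \<Rightarrow> ((nat \<Rightarrow> real) \<Rightarrow> real) \<Rightarrow> (nat \<Rightarrow> real) \<Rightarrow> ennreal" where
  "MB \<kappa> d g x = (SUP \<theta>\<in>{0<..pi}.
     (\<integral>\<^sup>+ y\<in>ballB d. ennreal (\<bar>g y\<bar> * VkB \<kappa> d (indicator (capE d x \<theta>)) (liftY d y) * WB \<kappa> d y) \<partial>lebd d)
     / (\<integral>\<^sup>+ y\<in>ballB d. ennreal (VkB \<kappa> d (indicator (capE d x \<theta>)) (liftY d y) * WB \<kappa> d y) \<partial>lebd d))"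

text \<open>(MT f) o psi = MB (f o psi); evaluated at the canonical preimage (sqrt x_i) of x.\<close>
definition MT :: "(nat \<Rightarrow> real) \<Rightarrow> nat \<Rightarrow> ((nat \<Rightarrow> real) \<Rightarrow> real) \<Rightarrow> (nat \<Rightarrow> real) \<Rightarrow> ennreal" where
  "MT \<kappa> d f x = MB \<kappa> d (f \<circ> psi d) (restrict (\<lambda>i. sqrt (x i)) {..<d})"

definition MTd :: "(nat \<Rightarrow> real) \<Rightarrow> nat \<Rightarrow> ((nat \<Rightarrow> real) \<Rightarrow> real) \<Rightarrow> (nat \<Rightarrow> real) \<Rightarrow> ennreal" where
  "MTd \<kappa> d f x = (SUP \<theta>\<in>{0<..pi}.
     (\<integral>\<^sup>+ y\<in>{y\<in>simplexT d. dT d x y \<le> \<theta>}. ennreal (\<bar>f y\<bar> * WT \<kappa> d y) \<partial>lebd d)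
     / (\<integral>\<^sup>+ y\<in>{y\<in>simplexT d. dT d x y \<le> \<theta>}. ennreal (WT \<kappa> d y) \<partial>lebd d))"

end

theory Submission
  imports Defs
begin

text \<open>Write a for the image of x under square-root coordinates and z for the lift of y, both unit
  vectors in dimension d + 1. A parameter t contributes to V at (x, y, \<theta>) only if the inner product
  of a with (z_i t_i) is at least cos \<theta>; this forces the angle between a and |z| to be at most \<theta>, and
  a_i |z_i| (1 - |t_i|) to be at most \<theta>^2/2 for each i. Hence V is at most a constant times
  K = prod_i (\<theta> / (a_i + \<theta>))^(2 \<kappa>_i) times the indicator of the d_T-ball. Conversely V is at least
  a constant times K if z is nonnegative and the inner product of a and z exceeds cos \<theta> + \<theta>^2/50.
  The factor K cancels in the quotient, so that only a doubling property comparing these two caps is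
  needed. It becomes a product estimate after homogenization: the cone over a cap, cut off at radii
  between 1 and 1 + \<theta>, lies between two boxes of side comparable to \<theta>, and W_T is the angular part of
  the product weight prod_i p_i^(\<kappa>_i - 1/2).\<close>

subsection \<open>Changes of variables\<close>

text \<open>V has no lower bound by K on the whole cap. Where the inner product of a and z equals
  cos \<theta>, every t_i < 1 with a_i z_i > 0 already violates the constraint, so V can vanish at
  the edge. The slack \<theta>^2/50 is the room in which t may leave 1. Numerator and denominator
  are therefore compared over different caps, and this is what makes doubling necessary. The
  constant 50 is not sharp: 1 - cos \<theta> is at least \<theta>^2/8 on [0, pi], and moving by
  \<theta>/4 away from the ray through a costs at most \<theta>^2/16. K cancels because it is built
  from the a_i and not from the z_i; this is possible because |z_i| and a_i differ by at most
  \<theta> on the cap. A cap is not a product set, and the simplex constraint couples the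
  coordinates as well. The extra radial variable frees them, at the price of a radial integral
  common to both caps. The exponents \<kappa>_i - 1/2 may be negative; with p = y^2 the
  one-dimensional weight becomes 2 y^(2 \<kappa>_i), which is nondecreasing and harmless at
  0.\<close>

lemma nn_integral_lborel_square:
  fixes g :: "real \<Rightarrow> ennreal"
  assumes [measurable]: "g \<in> borel_measurable borel"
  shows "(\<integral>\<^sup>+y. ennreal (2 * y) * g (y\<^sup>2) \<partial>lborel) = (\<integral>\<^sup>+u. indicator {0..} u * g u \<partial>lborel)"
proof -
  have deriv: "((\<lambda>y::real. y\<^sup>2) has_real_derivative 2 * y) (at y)" for y
    by (rule DERIV_cong[OF DERIV_pow]) simp
  \<comment> \<open>\<open>ennreal (2 * y)\<close> truncates to 0 for negative y, so only the
    increasing branch of the square counts. The substitution is made on [0, n] and the limit taken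
    by monotone convergence.\<close>
  have eq: "(\<integral>\<^sup>+u. g u * indicator {0..(real n)\<^sup>2} u \<partial>lborel)
      = (\<integral>\<^sup>+y. g (y\<^sup>2) * ennreal (2 * y) * indicator {0..real n} y \<partial>lborel)" if "n > 0" for n
    using nn_integral_substitution_aux[OF assms _ deriv, of 0 "real n"] that
    by (auto intro!: continuous_intros)
  have "(\<integral>\<^sup>+y. ennreal (2 * y) * g (y\<^sup>2) \<partial>lborel)
      = (\<integral>\<^sup>+y. (SUP n. g (y\<^sup>2) * ennreal (2 * y) * indicator {0..real n} y) \<partial>lborel)"
  proof (rule nn_integral_cong)
    fix y :: real
    show "ennreal (2 * y) * g (y\<^sup>2) = (SUP n. g (y\<^sup>2) * ennreal (2 * y) * indicator {0..real n} y)"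
    proof (cases "y \<ge> 0")
      case True
      obtain n where "y \<le> real n" using real_arch_simple by blast
      then show ?thesis using True
        by (intro antisym SUP_least)
          (auto intro!: SUP_upper2[of n] simp: mult.commute split: split_indicator)
    qed (simp add: ennreal_neg)
  qed
  also have "\<dots> = (SUP n. \<integral>\<^sup>+y. g (y\<^sup>2) * ennreal (2 * y) * indicator {0..real n} y \<partial>lborel)"
    by (rule nn_integral_monotone_convergence_SUP)
      (auto simp: incseq_def le_fun_def split: split_indicator)
  also have "\<dots> = (SUP n. \<integral>\<^sup>+u. g u * indicator {0..(real n)\<^sup>2} u \<partial>lborel)"
  proof (rule SUP_cong)
    fix n :: nat
    show "(\<integral>\<^sup>+y. g (y\<^sup>2) * ennreal (2 * y) * indicator {0..real n} y \<partial>lborel)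
      = (\<integral>\<^sup>+u. g u * indicator {0..(real n)\<^sup>2} u \<partial>lborel)"
    proof (cases "n = 0")
      case True
      have *: "(\<integral>\<^sup>+y. h y * indicator {0..0} y \<partial>lborel) = 0" for h :: "real \<Rightarrow> ennreal"
        using nn_integral_null_set[of "{0..0::real}" lborel h] by simp
      show ?thesis using True by (simp add: * del: atLeastAtMost_singleton)
    qed (use eq in auto)
  qed simp
  also have "\<dots> = (\<integral>\<^sup>+u. (SUP n. g u * indicator {0..(real n)\<^sup>2} u) \<partial>lborel)"
    by (rule nn_integral_monotone_convergence_SUP[symmetric])
      (auto simp: incseq_def le_fun_def split: split_indicator intro: order_trans power_mono)
  also have "\<dots> = (\<integral>\<^sup>+u. indicator {0..} u * g u \<partial>lborel)"
  proof (rule nn_integral_cong)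
    fix u :: real
    show "(SUP n. g u * indicator {0..(real n)\<^sup>2} u) = indicator {0..} u * g u"
    proof (cases "u \<ge> 0")
      case True
      obtain n where "max 1 u \<le> real n" using real_arch_simple by blast
      then have "u \<le> (real n)\<^sup>2"
        using self_le_power[of "real n" 2] by linarith
      then show ?thesis using True
        by (intro antisym SUP_least)
          (auto intro!: SUP_upper2[of n] split: split_indicator)
    qed simp
  qed
  finally show ?thesis .
qed

text \<open>2 |y| is the sum of the positive parts of 2 y and of -2 y. The two resulting integrals
  agree by reflection, and each is given by the one-sided substitution.\<close>

lemma nn_integral_lborel_square_abs:
  fixes g :: "real \<Rightarrow> ennreal"
  assumes [measurable]: "g \<in> borel_measurable borel"
  shows "(\<integral>\<^sup>+y. ennreal \<bar>y\<bar> * g (y\<^sup>2) \<partial>lborel) = (\<integral>\<^sup>+u. indicator {0..} u * g u \<partial>lborel)"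
proof -
  let ?p = "\<lambda>y. ennreal (2 * y) * g (y\<^sup>2)"
  have "2 * (\<integral>\<^sup>+y. ennreal \<bar>y\<bar> * g (y\<^sup>2) \<partial>lborel) = (\<integral>\<^sup>+y. 2 * (ennreal \<bar>y\<bar> * g (y\<^sup>2)) \<partial>lborel)"
    by (rule nn_integral_cmult[symmetric]) auto
  \<comment> \<open>-y is written as \<open>0 + (-1) * y\<close> to match the affine map of
    \<open>nn_integral_real_affine\<close>.\<close>
  also have "\<dots> = (\<integral>\<^sup>+y. ?p y + ?p (0 + (-1) * y) \<partial>lborel)"
  proof (intro nn_integral_cong)
    fix y :: real
    have "2 * ennreal \<bar>y\<bar> = ennreal (2 * \<bar>y\<bar>)"
      by (simp add: ennreal_mult')
    also have "\<dots> = ennreal (2 * y) + ennreal (2 * (0 + (-1) * y))"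
      by (simp add: abs_if ennreal_neg)
    finally have *: "2 * ennreal \<bar>y\<bar> = ennreal (2 * y) + ennreal (2 * (0 + (-1) * y))" .
    have "(0 + (-1) * y)\<^sup>2 = y\<^sup>2" by simp
    then show "2 * (ennreal \<bar>y\<bar> * g (y\<^sup>2)) = ?p y + ?p (0 + (-1) * y)"
      by (simp only: mult.assoc[symmetric] * distrib_right)
  qed
  also have "\<dots> = (\<integral>\<^sup>+y. ?p y \<partial>lborel) + (\<integral>\<^sup>+y. ?p (0 + (-1) * y) \<partial>lborel)"
    by (rule nn_integral_add) auto
  also have "(\<integral>\<^sup>+y. ?p (0 + (-1) * y) \<partial>lborel) = (\<integral>\<^sup>+y. ?p y \<partial>lborel)"
    using nn_integral_real_affine[of ?p "-1" 0] by simp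
  also have "(\<integral>\<^sup>+y. ?p y \<partial>lborel) = (\<integral>\<^sup>+u. indicator {0..} u * g u \<partial>lborel)"
    by (rule nn_integral_lborel_square) simp
  finally show ?thesis
    by (simp only: mult_2[symmetric] ennreal_mult_cancel_left) simp
qed

lemma product_sigma_finite_lborel: "product_sigma_finite (\<lambda>_. lborel :: real measure)"
  by standard

text \<open>Hypothesis \<open>sub\<close> says that T i carries the measure w i dy to v i du.
  Coordinatewise images of product measures are products of the images. Instances used later are
  squaring, with weight |y| or 2 y, and multiplication by a positive constant.\<close>

lemma nn_integral_PiM_lborel_substitution:
  fixes T :: "'i \<Rightarrow> real \<Rightarrow> real" and w v :: "'i \<Rightarrow> real \<Rightarrow> ennreal"
  assumes "finite I"
    and T: "\<And>i. i \<in> I \<Longrightarrow> T i \<in> borel_measurable borel"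
    and w: "\<And>i. i \<in> I \<Longrightarrow> w i \<in> borel_measurable borel"
    and v: "\<And>i. i \<in> I \<Longrightarrow> v i \<in> borel_measurable borel"
    and sub: "\<And>i g. i \<in> I \<Longrightarrow> g \<in> borel_measurable borel \<Longrightarrow>
        (\<integral>\<^sup>+y. w i y * g (T i y) \<partial>lborel) = (\<integral>\<^sup>+u. v i u * g u \<partial>lborel)"
    and "G \<in> borel_measurable (\<Pi>\<^sub>M i\<in>I. lborel)"
  shows "(\<integral>\<^sup>+y. (\<Prod>i\<in>I. w i (y i)) * G (\<lambda>i\<in>I. T i (y i)) \<partial>(\<Pi>\<^sub>M i\<in>I. lborel))
       = (\<integral>\<^sup>+u. (\<Prod>i\<in>I. v i (u i)) * G u \<partial>(\<Pi>\<^sub>M i\<in>I. lborel))"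
  using assms
proof (induction I arbitrary: G)
  case empty
  interpret product_sigma_finite "\<lambda>_::'i. lborel :: real measure" by (rule product_sigma_finite_lborel)
  show ?case by (simp add: nn_integral_empty restrict_def PiM_empty nn_integral_count_space_finite)
next
  case (insert j I)
  interpret product_sigma_finite "\<lambda>_::'i. lborel :: real measure" by (rule product_sigma_finite_lborel)
  note insert.prems(5)[simplified, measurable]
  note [simp] = \<open>finite I\<close> \<open>j \<notin> I\<close>
  have [measurable]: "T i \<in> borel_measurable borel" "w i \<in> borel_measurable borel"
    "v i \<in> borel_measurable borel" if "i \<in> insert j I" for i
    using insert.prems that by auto
  have res: "(\<lambda>i\<in>insert j I. T i ((x(j := y)) i)) = (\<lambda>i\<in>I. T i (x i))(j := T j y)" for x y
    by (auto simp: fun_eq_iff)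
  have prw: "(\<Prod>i\<in>I. f i ((x(j := y)) i)) = (\<Prod>i\<in>I. f i (x i))" for f :: "'i \<Rightarrow> real \<Rightarrow> ennreal" and x y
    by (rule prod.cong) auto
  have "(\<integral>\<^sup>+y. (\<Prod>i\<in>insert j I. w i (y i)) * G (\<lambda>i\<in>insert j I. T i (y i)) \<partial>(\<Pi>\<^sub>M i\<in>insert j I. lborel))
     = (\<integral>\<^sup>+x. \<integral>\<^sup>+y. (\<Prod>i\<in>insert j I. w i ((x(j := y)) i)) * G (\<lambda>i\<in>insert j I. T i ((x(j := y)) i)) \<partial>lborel \<partial>(\<Pi>\<^sub>M i\<in>I. lborel))"
    by (rule product_nn_integral_insert) simp_all
  also have "\<dots> = (\<integral>\<^sup>+x. (\<Prod>i\<in>I. w i (x i)) * (\<integral>\<^sup>+y. w j y * G ((\<lambda>i\<in>I. T i (x i))(j := T j y)) \<partial>lborel) \<partial>(\<Pi>\<^sub>M i\<in>I. lborel))"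
    apply (intro nn_integral_cong)
    apply (subst nn_integral_cmult[symmetric])
    subgoal by measurable
    subgoal by (simp only: res prw prod.insert \<open>finite I\<close> \<open>j \<notin> I\<close> not_False_eq_True fun_upd_same mult_ac)
    done
  \<comment> \<open>With coordinate j integrated out, what remains is a function of the transformed
    other coordinates, and it takes the place of G in the induction hypothesis.\<close>
  also have "\<dots> = (\<integral>\<^sup>+x. (\<Prod>i\<in>I. w i (x i)) * (\<lambda>x'. \<integral>\<^sup>+u. v j u * G (x'(j := u)) \<partial>lborel) (\<lambda>i\<in>I. T i (x i)) \<partial>(\<Pi>\<^sub>M i\<in>I. lborel))"
    apply (intro nn_integral_cong)
    apply (subst insert.prems(4)[where i = j])
      apply simp
     apply (rule measurable_compose[OF _ insert.prems(5)])
     apply measurable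
      apply (auto simp: space_PiM)
    done
  also have "\<dots> = (\<integral>\<^sup>+x. (\<Prod>i\<in>I. v i (x i)) * (\<integral>\<^sup>+u. v j u * G (x(j := u)) \<partial>lborel) \<partial>(\<Pi>\<^sub>M i\<in>I. lborel))"
  proof (rule insert.IH)
    show "(\<lambda>x. \<integral>\<^sup>+u. v j u * G (x(j := u)) \<partial>lborel) \<in> borel_measurable (\<Pi>\<^sub>M i\<in>I. lborel)"
      by measurable
  qed (use insert.prems in auto)
  also have "\<dots> = (\<integral>\<^sup>+x. \<integral>\<^sup>+u. (\<Prod>i\<in>insert j I. v i ((x(j := u)) i)) * G (x(j := u)) \<partial>lborel \<partial>(\<Pi>\<^sub>M i\<in>I. lborel))"
    apply (intro nn_integral_cong)
    apply (subst nn_integral_cmult[symmetric])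
    subgoal by measurable
    subgoal by (simp only: prw prod.insert \<open>finite I\<close> \<open>j \<notin> I\<close> not_False_eq_True fun_upd_same mult_ac)
    done
  also have "\<dots> = (\<integral>\<^sup>+u. (\<Prod>i\<in>insert j I. v i (u i)) * G u \<partial>(\<Pi>\<^sub>M i\<in>insert j I. lborel))"
    by (rule product_nn_integral_insert[symmetric]) simp_all
  finally show ?case .
qed

lemma nn_integral_lborel_powr_from_0:
  fixes u k :: real
  assumes "0 < k" "0 \<le> u"
  shows "(\<integral>\<^sup>+s. ennreal (s powr (k - 1)) * indicator {0..u} s \<partial>lborel) = ennreal (u powr k / k)"
  using assms has_integral_powr_from_0[of "k - 1" u]
  by (simp add: nn_integral_has_integral_lebesgue')

subsection \<open>The one-dimensional measures of V\<close>

lemma sets_kmeas [simp, measurable_cong]: "sets (kmeas k) = sets borel"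
  by (simp add: kmeas_def)

lemma space_kmeas [simp]: "space (kmeas k) = UNIV"
  by (simp add: kmeas_def)

lemma nn_integral_powr_one_minus_abs_le:
  fixes k u :: real
  assumes "0 < k" "0 \<le> u" "u \<le> 1"
  shows "(\<integral>\<^sup>+t. ennreal ((1 - \<bar>t\<bar>) powr (k - 1)) * indicator {t. 1 - u \<le> \<bar>t\<bar> \<and> \<bar>t\<bar> \<le> 1} t \<partial>lborel)
       \<le> ennreal (2 * u powr k / k)"
proof -
  let ?h = "\<lambda>s. ennreal (s powr (k - 1)) * indicator {0..u} s"
  have h: "(\<integral>\<^sup>+s. ?h (1 + c * s) \<partial>lborel) = ennreal (u powr k / k)" if "c = 1 \<or> c = -1" for c
    using nn_integral_real_affine[of ?h c 1] nn_integral_lborel_powr_from_0[of k u] assms that by auto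
  have "(\<integral>\<^sup>+t. ennreal ((1 - \<bar>t\<bar>) powr (k - 1)) * indicator {t. 1 - u \<le> \<bar>t\<bar> \<and> \<bar>t\<bar> \<le> 1} t \<partial>lborel)
      \<le> (\<integral>\<^sup>+t. ?h (1 + (-1) * t) + ?h (1 + 1 * t) \<partial>lborel)"
    by (rule nn_integral_mono) (auto split: split_indicator simp: abs_if)
  also have "\<dots> = ennreal (u powr k / k) + ennreal (u powr k / k)"
    by (subst nn_integral_add) (use h[of 1] h[of "-1"] in auto)
  also have "\<dots> = ennreal (2 * u powr k / k)"
    using assms by (simp add: ennreal_plus[symmetric] del: ennreal_plus)
  finally show ?thesis .
qed

text \<open>1 - t^2 factors as (1 - |t|)(1 + |t|), and only the first factor can be singular.
  Raising the exponent of the second from k - 1 to k treats k < 1 and k \<ge> 1 alike, since its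
  base lies in [1, 2].\<close>

lemma kmeas_weight_le:
  fixes k t :: real
  assumes "0 < k" "\<bar>t\<bar> \<le> 1"
  shows "(1 + t) * (1 - t\<^sup>2) powr (k - 1) \<le> 2 * 2 powr k * (1 - \<bar>t\<bar>) powr (k - 1)"
proof -
  have "1 - t\<^sup>2 = (1 - \<bar>t\<bar>) * (1 + \<bar>t\<bar>)"
    by (simp add: algebra_simps power2_eq_square abs_mult_self_eq)
  then have "(1 - t\<^sup>2) powr (k - 1) = (1 - \<bar>t\<bar>) powr (k - 1) * (1 + \<bar>t\<bar>) powr (k - 1)"
    using assms by (simp add: powr_mult)
  moreover have "(1 + \<bar>t\<bar>) powr (k - 1) \<le> (1 + \<bar>t\<bar>) powr k"
    using assms by (intro powr_mono) auto
  moreover have "(1 + \<bar>t\<bar>) powr k \<le> 2 powr k"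
    using assms by (intro powr_mono2) auto
  ultimately have "(1 - t\<^sup>2) powr (k - 1) \<le> (1 - \<bar>t\<bar>) powr (k - 1) * 2 powr k"
    by (auto intro!: mult_left_mono)
  then have "(1 + t) * (1 - t\<^sup>2) powr (k - 1) \<le> 2 * ((1 - \<bar>t\<bar>) powr (k - 1) * 2 powr k)"
    using assms by (intro mult_mono) auto
  then show ?thesis by (simp add: mult_ac)
qed

text \<open>The factor 1 + t lifts the exponent of the regular part from k - 1 to k, so that part is
  at least 1 for every k > 0.\<close>

lemma kmeas_weight_ge:
  fixes k t :: real
  assumes "0 < k" "0 \<le> t" "t \<le> 1"
  shows "(1 - t) powr (k - 1) \<le> (1 + t) * (1 - t\<^sup>2) powr (k - 1)"
proof -
  have "1 - t\<^sup>2 = (1 - t) * (1 + t)"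
    by (simp add: algebra_simps power2_eq_square)
  then have "(1 + t) * (1 - t\<^sup>2) powr (k - 1) = (1 - t) powr (k - 1) * (1 + t) powr k"
    using assms by (simp add: powr_mult powr_mult_base[of "1 + t" "k - 1"] mult_ac)
  moreover have "1 \<le> (1 + t) powr k"
    using assms by (intro ge_one_powr_ge_zero) auto
  ultimately show ?thesis
    using mult_left_mono[of 1 "(1 + t) powr k" "(1 - t) powr (k - 1)"] by simp
qed

lemma kmeas_weight_integral_upper:
  fixes k u :: real
  assumes "0 < k" "0 \<le> u" "u \<le> 1"
  shows "(\<integral>\<^sup>+t. ennreal (indicator {-1..1} t * (1 + t) * (1 - t\<^sup>2) powr (k - 1)) * indicator {t. 1 - u \<le> \<bar>t\<bar>} t \<partial>lborel)
       \<le> ennreal (4 * 2 powr k / k * u powr k)" (is "?L \<le> _")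
proof -
  have "?L \<le> (\<integral>\<^sup>+t. ennreal (2 * 2 powr k) * (ennreal ((1 - \<bar>t\<bar>) powr (k - 1)) * indicator {t. 1 - u \<le> \<bar>t\<bar> \<and> \<bar>t\<bar> \<le> 1} t) \<partial>lborel)"
    using kmeas_weight_le[OF \<open>0 < k\<close>]
    by (intro nn_integral_mono) (auto split: split_indicator simp: ennreal_mult'[symmetric] abs_le_iff intro!: ennreal_leI)
  also have "\<dots> = ennreal (2 * 2 powr k) * (\<integral>\<^sup>+t. (ennreal ((1 - \<bar>t\<bar>) powr (k - 1)) * indicator {t. 1 - u \<le> \<bar>t\<bar> \<and> \<bar>t\<bar> \<le> 1} t) \<partial>lborel)"
    by (rule nn_integral_cmult) measurable
  also have "\<dots> \<le> ennreal (2 * 2 powr k) * ennreal (2 * u powr k / k)"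
    by (intro mult_left_mono nn_integral_powr_one_minus_abs_le assms) simp
  also have "\<dots> = ennreal (4 * 2 powr k / k * u powr k)"
    using assms by (simp add: ennreal_mult'[symmetric])
  finally show ?thesis .
qed

lemma kmeas_weight_integral_lower:
  fixes k u :: real
  assumes "0 < k" "0 \<le> u" "u \<le> 1"
  shows "ennreal (u powr k / k)
      \<le> (\<integral>\<^sup>+t. ennreal (indicator {-1..1} t * (1 + t) * (1 - t\<^sup>2) powr (k - 1)) * indicator {1 - u..1} t \<partial>lborel)"
proof -
  let ?h = "\<lambda>s. ennreal (s powr (k - 1)) * indicator {0..u} s"
  have "ennreal (u powr k / k) = (\<integral>\<^sup>+t. ?h (1 + (-1) * t) \<partial>lborel)"
    using nn_integral_real_affine[of ?h "-1" 1] nn_integral_lborel_powr_from_0[of k u] assms by auto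
  also have "\<dots> \<le> (\<integral>\<^sup>+t. ennreal (indicator {-1..1} t * (1 + t) * (1 - t\<^sup>2) powr (k - 1)) * indicator {1 - u..1} t \<partial>lborel)"
    using kmeas_weight_ge[OF \<open>0 < k\<close>] assms
    by (intro nn_integral_mono) (auto split: split_indicator intro!: ennreal_leI)
  finally show ?thesis .
qed

text \<open>\<open>kmeas\<close> divides by a Bochner integral, which would be 0 by default if it
  diverged. Finiteness and positivity come from the two tail estimates at u = 1.\<close>

lemma kmeas_normalization:
  fixes k :: real
  assumes "0 < k"
  defines "Z \<equiv> (\<integral>s. indicator {-1..1} s * (1 + s) * (1 - s\<^sup>2) powr (k - 1) \<partial>lborel)"
  shows "0 < Z"
    and "(\<integral>\<^sup>+s. ennreal (indicator {-1..1} s * (1 + s) * (1 - s\<^sup>2) powr (k - 1)) \<partial>lborel) = ennreal Z"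
proof -
  let ?D = "\<lambda>s::real. indicator {-1..1} s * (1 + s) * (1 - s\<^sup>2) powr (k - 1)"
  let ?N = "\<integral>\<^sup>+s. ennreal (?D s) \<partial>lborel"
  have nn: "0 \<le> ?D s" for s
    by (auto split: split_indicator)
  have "?N \<le> ennreal (4 * 2 powr k / k * 1 powr k)"
    using kmeas_weight_integral_upper[of k 1] assms by simp
  then have fin: "?N < \<infinity>"
    by (rule le_less_trans) simp
  have "ennreal (1 powr k / k) \<le> (\<integral>\<^sup>+t. ennreal (?D t) * indicator {1 - 1..1} t \<partial>lborel)"
    by (rule kmeas_weight_integral_lower) (use assms in auto)
  also have "\<dots> \<le> ?N"
    by (intro nn_integral_mono) (auto split: split_indicator)
  finally have pos: "ennreal (1 / k) \<le> ?N" by simp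
  have "integrable lborel ?D"
    using fin by (intro integrableI_nonneg) (auto simp: nn)
  then show *: "?N = ennreal Z"
    unfolding Z_def by (intro nn_integral_eq_integral) (auto simp: nn)
  show "0 < Z"
    using pos assms(1) unfolding * by (auto simp: ennreal_le_iff2 dest: less_le_trans)
qed

lemma emeasure_kmeas:
  fixes k :: real
  assumes "0 < k" and [measurable]: "A \<in> sets borel"
  shows "emeasure (kmeas k) A =
    ennreal (1 / (\<integral>s. indicator {-1..1} s * (1 + s) * (1 - s\<^sup>2) powr (k - 1) \<partial>lborel)) *
    (\<integral>\<^sup>+t. ennreal (indicator {-1..1} t * (1 + t) * (1 - t\<^sup>2) powr (k - 1)) * indicator A t \<partial>lborel)"
proof -
  define Z :: real where "Z = (\<integral>s. indicator {-1..1} s * (1 + s) * (1 - s\<^sup>2) powr (k - 1) \<partial>lborel)"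
  have Z: "0 < Z"
    using kmeas_normalization(1)[OF assms(1)] by (simp add: Z_def)
  have "emeasure (kmeas k) A
      = (\<integral>\<^sup>+t. ennreal (indicator {-1..1} t * (1 + t) * (1 - t\<^sup>2) powr (k - 1) / Z) * indicator A t \<partial>lborel)"
    using assms by (simp add: kmeas_def emeasure_density Z_def)
  also have "\<dots> = (\<integral>\<^sup>+t. ennreal (1 / Z) * (ennreal (indicator {-1..1} t * (1 + t) * (1 - t\<^sup>2) powr (k - 1)) * indicator A t) \<partial>lborel)"
    using Z by (intro nn_integral_cong) (auto split: split_indicator simp: ennreal_mult'[symmetric])
  also have "\<dots> = ennreal (1 / Z) * (\<integral>\<^sup>+t. ennreal (indicator {-1..1} t * (1 + t) * (1 - t\<^sup>2) powr (k - 1)) * indicator A t \<partial>lborel)"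
    by (rule nn_integral_cmult) measurable
  finally show ?thesis unfolding Z_def .
qed

lemma prob_space_kmeas:
  assumes "0 \<le> k"
  shows "prob_space (kmeas k)"
proof (cases "k = 0")
  case True
  then show ?thesis
    by (auto simp: kmeas_def intro!: measure_pmf.prob_space_distr)
next
  case False
  then have k: "0 < k" using assms by simp
  show ?thesis
    by (rule prob_spaceI)
      (use emeasure_kmeas[OF k, of UNIV] kmeas_normalization[OF k] in \<open>simp add: ennreal_mult'[symmetric]\<close>)
qed

lemma AE_kmeas_abs_le_1:
  assumes "0 \<le> k"
  shows "AE t in kmeas k. \<bar>t\<bar> \<le> 1"
proof (cases "k = 0")
  case True
  then show ?thesis
    unfolding kmeas_def by (subst if_P, assumption, subst AE_distr_iff) (auto simp: AE_measure_pmf_iff)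
next
  case False
  then show ?thesis
    unfolding kmeas_def
    by (subst if_not_P, assumption, subst AE_density) (auto split: split_indicator)
qed

text \<open>The density is of order at most (1 - |t|)^(k-1) near both ends, which integrates to
  order u^k. For k = 0 the bound is trivial, as \<open>u powr 0\<close> is 1 for u > 0 and the
  measure has mass 1.\<close>

lemma emeasure_kmeas_upper:
  assumes "0 \<le> k"
  shows "\<exists>C>0. \<forall>u. 0 < u \<and> u \<le> 1 \<longrightarrow> emeasure (kmeas k) {t. 1 - u \<le> \<bar>t\<bar>} \<le> ennreal (C * u powr k)"
proof (cases "k = 0")
  case True
  interpret prob_space "kmeas k" by (rule prob_space_kmeas) fact
  have "emeasure (kmeas k) A \<le> 1" for A
    using emeasure_space[of "kmeas k" A] emeasure_space_1 by simp
  then show ?thesis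
    by (intro exI[of _ 1]) (auto simp: True)
next
  case False
  then have k: "0 < k" using assms by simp
  define Z :: real where "Z = (\<integral>s. indicator {-1..1} s * (1 + s) * (1 - s\<^sup>2) powr (k - 1) \<partial>lborel)"
  have Z: "0 < Z"
    using kmeas_normalization(1)[OF k] by (simp add: Z_def)
  have "emeasure (kmeas k) {t. 1 - u \<le> \<bar>t\<bar>} \<le> ennreal (1 / Z * (4 * 2 powr k / k) * u powr k)"
    if "0 < u" "u \<le> 1" for u
  proof -
    have "emeasure (kmeas k) {t. 1 - u \<le> \<bar>t\<bar>}
      = ennreal (1 / Z) * (\<integral>\<^sup>+t. ennreal (indicator {-1..1} t * (1 + t) * (1 - t\<^sup>2) powr (k - 1)) * indicator {t. 1 - u \<le> \<bar>t\<bar>} t \<partial>lborel)"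
      unfolding Z_def by (rule emeasure_kmeas[OF k]) measurable
    also have "\<dots> \<le> ennreal (1 / Z) * ennreal (4 * 2 powr k / k * u powr k)"
      by (intro mult_left_mono kmeas_weight_integral_upper) (use that k in auto)
    also have "\<dots> = ennreal (1 / Z * (4 * 2 powr k / k) * u powr k)"
      using Z k by (simp add: ennreal_mult'[symmetric])
    finally show ?thesis .
  qed
  then show ?thesis
    using Z k by (intro exI[of _ "1 / Z * (4 * 2 powr k / k)"]) auto
qed

text \<open>Only the end t = 1 is claimed, because near -1 the factor 1 + t depresses the density.
  For k = 0 the atom at 1 supplies mass 1/2.\<close>

lemma emeasure_kmeas_lower:
  assumes "0 \<le> k"
  shows "\<exists>c>0. \<forall>u. 0 < u \<and> u \<le> 1 \<longrightarrow> ennreal (c * u powr k) \<le> emeasure (kmeas k) {1 - u..1}"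
proof (cases "k = 0")
  case True
  have "ennreal (1 / 2 * u powr k) \<le> emeasure (kmeas k) {1 - u..1}" if "0 < u" "u \<le> 1" for u :: real
  proof -
    have "ennreal (1 / 2 * u powr k) = ennreal (pmf (pmf_of_set {-1, 1::real}) 1)"
      using that True by (simp add: pmf_of_set)
    also have "\<dots> = emeasure (measure_pmf (pmf_of_set {-1, 1::real})) {1}"
      by (simp add: emeasure_pmf_single)
    also have "\<dots> \<le> emeasure (measure_pmf (pmf_of_set {-1, 1::real})) {1 - u..1}"
      using that by (intro emeasure_mono) auto
    also have "\<dots> = emeasure (kmeas k) {1 - u..1}"
      using True by (simp add: kmeas_def emeasure_distr)
    finally show ?thesis .
  qed
  then show ?thesis by (intro exI[of _ "1 / 2"]) auto
next
  case False
  then have k: "0 < k" using assms by simp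
  define Z :: real where "Z = (\<integral>s. indicator {-1..1} s * (1 + s) * (1 - s\<^sup>2) powr (k - 1) \<partial>lborel)"
  have Z: "0 < Z"
    using kmeas_normalization(1)[OF k] by (simp add: Z_def)
  have "ennreal (1 / Z * (1 / k) * u powr k) \<le> emeasure (kmeas k) {1 - u..1}"
    if "0 < u" "u \<le> 1" for u
  proof -
    have "ennreal (1 / Z * (1 / k) * u powr k) = ennreal (1 / Z) * ennreal (u powr k / k)"
      using Z k by (simp add: ennreal_mult'[symmetric])
    also have "\<dots> \<le> ennreal (1 / Z) * (\<integral>\<^sup>+t. ennreal (indicator {-1..1} t * (1 + t) * (1 - t\<^sup>2) powr (k - 1)) * indicator {1 - u..1} t \<partial>lborel)"
      by (intro mult_left_mono kmeas_weight_integral_lower) (use that k in auto)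
    also have "\<dots> = emeasure (kmeas k) {1 - u..1}"
      unfolding Z_def by (rule emeasure_kmeas[OF k, symmetric]) measurable
    finally show ?thesis .
  qed
  then show ?thesis
    using Z k by (intro exI[of _ "1 / Z * (1 / k)"]) auto
qed

subsection \<open>Geometry of unit vectors\<close>

lemma one_minus_cos_le: "1 - cos \<theta> \<le> \<theta>\<^sup>2 / 2" for \<theta> :: real
proof -
  have "1 - cos \<theta> = 2 * (sin (\<theta> / 2))\<^sup>2"
    using cos_double_sin[of "\<theta> / 2"] by simp
  also have "(sin (\<theta> / 2))\<^sup>2 \<le> (\<theta> / 2)\<^sup>2"
    using abs_sin_x_le_abs_x[of "\<theta> / 2"] by (simp only: abs_le_square_iff)
  finally show ?thesis by (simp add: power_divide)
qed

text \<open>With y = \<theta>/2 at most pi/2 < 1.6, the Maclaurin bound of order 3 and y^2 \<le> 3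
  give sin y \<ge> y/2. The sharp constant would be 2/pi^2, but 1/8 is enough.\<close>

lemma one_minus_cos_ge:
  fixes \<theta> :: real
  assumes "0 \<le> \<theta>" "\<theta> \<le> pi"
  shows "\<theta>\<^sup>2 / 8 \<le> 1 - cos \<theta>"
proof -
  define y where "y = \<theta> / 2"
  have y: "0 \<le> y" "y \<le> 16 / 10"
    using assms pi_approx(2) by (auto simp: y_def)
  have "\<bar>sin y - y\<bar> \<le> y ^ 3 / 6"
    using Maclaurin_sin_bound[of y 3] y
    by (simp add: eval_nat_numeral sin_coeff_def divide_simps)
  moreover have "y ^ 3 / 6 \<le> y / 2"
  proof -
    have "y\<^sup>2 \<le> (16 / 10)\<^sup>2"
      using y by (intro power_mono) auto
    then have "y * y\<^sup>2 \<le> y * 3"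
      using y by (intro mult_left_mono) (auto simp: power2_eq_square)
    then show ?thesis by (simp add: power3_eq_cube power2_eq_square)
  qed
  ultimately have "y / 2 \<le> sin y" by linarith
  then have "(y / 2)\<^sup>2 \<le> (sin y)\<^sup>2"
    using y by (intro power_mono) auto
  moreover have "1 - cos \<theta> = 2 * (sin y)\<^sup>2"
    using cos_double_sin[of y] by (simp add: y_def)
  ultimately show ?thesis by (simp add: y_def power_divide)
qed

text \<open>A coordinate difference is at most the chord, whose square is 2 - 2 cos of the angle,
  and this is at most \<theta>^2.\<close>

lemma unit_vectors_component_dist_le:
  fixes a v :: "'i \<Rightarrow> real"
  assumes "finite I" "(\<Sum>i\<in>I. (a i)\<^sup>2) = 1" "(\<Sum>i\<in>I. (v i)\<^sup>2) = 1"
    and "cos \<theta> \<le> (\<Sum>i\<in>I. a i * v i)" "0 \<le> \<theta>" "j \<in> I"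
  shows "\<bar>v j - a j\<bar> \<le> \<theta>"
proof -
  have "(v j - a j)\<^sup>2 \<le> (\<Sum>i\<in>I. (v i - a i)\<^sup>2)"
    using assms by (intro member_le_sum) auto
  also have "\<dots> = 2 - 2 * (\<Sum>i\<in>I. a i * v i)"
    using assms(2,3) by (simp add: power2_diff sum.distrib sum_subtractf sum_distrib_left mult_ac)
  also have "\<dots> \<le> \<theta>\<^sup>2"
    using assms(4) one_minus_cos_le[of \<theta>] by simp
  finally show ?thesis
    using assms(5) by (metis abs_le_square_iff abs_of_nonneg)
qed

text \<open>The base point is taken at radius 1 + \<theta>/2 on the ray through a, in the middle of
  the shell, so that a displacement of at most \<theta>/4 stays inside it. Nonnegativity of e makes
  the inner radius bound immediate. The direction of q stays close to a because its squared distance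
  from the line through a is at most \<theta>^2/16 and its radius is at least 1.\<close>

lemma perturbed_ray_in_cone:
  fixes a e :: "'i \<Rightarrow> real"
  assumes "finite I" and a1: "(\<Sum>i\<in>I. (a i)\<^sup>2) = 1" and a: "\<And>i. i \<in> I \<Longrightarrow> 0 \<le> a i"
    and e: "\<And>i. i \<in> I \<Longrightarrow> 0 \<le> e i" "(\<Sum>i\<in>I. e i) \<le> \<theta> / 4"
    and \<theta>: "0 < \<theta>" "\<theta> \<le> pi"
  defines "q \<equiv> \<lambda>i. (1 + \<theta> / 2) * a i + e i"
  shows "1 \<le> (\<Sum>i\<in>I. (q i)\<^sup>2)"
    and "(\<Sum>i\<in>I. (q i)\<^sup>2) \<le> (1 + \<theta>)\<^sup>2"
    and "sqrt (\<Sum>i\<in>I. (q i)\<^sup>2) * (cos \<theta> + \<theta>\<^sup>2 / 50) \<le> (\<Sum>i\<in>I. a i * q i)"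
proof -
  define \<epsilon> where "\<epsilon> = (\<Sum>i\<in>I. e i)"
  define m where "m = 1 + \<theta> / 2"
  define h where "h = (\<Sum>i\<in>I. a i * q i)"
  define R where "R = (\<Sum>i\<in>I. (q i)\<^sup>2)"
  define E where "E = (\<Sum>i\<in>I. (e i)\<^sup>2)"
  define b where "b = (\<Sum>i\<in>I. a i * e i)"
  have \<epsilon>: "0 \<le> \<epsilon>" "\<epsilon> \<le> \<theta> / 4"
    using e by (auto simp: \<epsilon>_def sum_nonneg)
  have m: "1 \<le> m" using \<theta> by (simp add: m_def)
  have a_le: "a i \<le> 1" if "i \<in> I" for i
  proof -
    have "(a i)\<^sup>2 \<le> 1"
      unfolding a1[symmetric] using assms(1) that by (intro member_le_sum) auto
    then show ?thesis using power2_le_imp_le[of "a i" 1] by simp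
  qed
  have b: "0 \<le> b" "b \<le> \<epsilon>"
    unfolding b_def \<epsilon>_def using a e a_le
    by (auto intro!: sum_nonneg sum_mono mult_left_le_one_le)
  have E: "0 \<le> E" "E \<le> \<epsilon>\<^sup>2"
  proof -
    show "0 \<le> E" by (simp add: E_def sum_nonneg)
    have "E \<le> (\<Sum>i\<in>I. \<epsilon> * e i)"
      unfolding E_def power2_eq_square \<epsilon>_def using assms(1) e
      by (intro sum_mono mult_right_mono member_le_sum) auto
    then show "E \<le> \<epsilon>\<^sup>2"
      by (simp add: \<epsilon>_def power2_eq_square sum_distrib_left)
  qed
  have h: "h = m + b"
  proof -
    have "h = (\<Sum>i\<in>I. m * (a i)\<^sup>2 + a i * e i)"
      unfolding h_def q_def m_def by (intro sum.cong) (auto simp: algebra_simps power2_eq_square)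
    then show ?thesis
      by (simp add: sum.distrib sum_distrib_left[symmetric] a1 b_def)
  qed
  have R: "R = m\<^sup>2 + 2 * m * b + E"
  proof -
    have "R = (\<Sum>i\<in>I. m\<^sup>2 * (a i)\<^sup>2 + 2 * m * (a i * e i) + (e i)\<^sup>2)"
      unfolding R_def q_def m_def[symmetric] by (intro sum.cong) (auto simp: algebra_simps power2_eq_square)
    then show ?thesis
      by (simp add: sum.distrib sum_distrib_left[symmetric] a1 b_def E_def)
  qed
  have R1: "1 \<le> R"
    unfolding R using m b E by (smt (verit) mult_nonneg_nonneg one_le_power)
  then show "1 \<le> (\<Sum>i\<in>I. (q i)\<^sup>2)" unfolding R_def .
  have "R \<le> (m + \<epsilon>)\<^sup>2"
    unfolding R power2_sum using m b E mult_left_mono[of b \<epsilon> "2 * m"] by linarith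
  also have "\<dots> \<le> (1 + \<theta>)\<^sup>2"
    using \<epsilon> m \<theta> by (intro power_mono) (auto simp: m_def)
  finally show "(\<Sum>i\<in>I. (q i)\<^sup>2) \<le> (1 + \<theta>)\<^sup>2" unfolding R_def .
  \<comment> \<open>Pythagoras: h is the component of q along the unit vector a, and R - h^2 is the
    squared distance of q from the line through a.\<close>
  have "(\<Sum>i\<in>I. (q i - h * a i)\<^sup>2) = (\<Sum>i\<in>I. (q i)\<^sup>2 - 2 * h * (a i * q i) + h\<^sup>2 * (a i)\<^sup>2)"
    by (intro sum.cong) (auto simp: algebra_simps power2_eq_square)
  also have "\<dots> = R - h\<^sup>2"
    by (simp add: sum.distrib sum_subtractf sum_distrib_left[symmetric] a1 R_def[symmetric] h_def[symmetric])
      (simp add: power2_eq_square)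
  finally have hR: "h\<^sup>2 \<le> R"
    using sum_nonneg[of I "\<lambda>i. (q i - h * a i)\<^sup>2"] by simp
  have Rh: "R - h\<^sup>2 \<le> \<epsilon>\<^sup>2"
    unfolding R h power2_sum using E zero_le_power2[of b] by linarith
  have h0: "0 \<le> h" using h m b by simp
  define \<rho> where "\<rho> = sqrt R"
  have \<rho>: "1 \<le> \<rho>" "\<rho>\<^sup>2 = R" "h \<le> \<rho>"
    using R1 hR h0 by (auto simp: \<rho>_def real_le_rsqrt)
  \<comment> \<open>\<epsilon>^2 takes at most \<theta>^2/16 out of the \<theta>^2/8 available, and
    \<theta>^2/50 fits into the rest.\<close>
  have \<theta>2: "cos \<theta> + \<theta>\<^sup>2 / 50 \<le> 1 - \<epsilon>\<^sup>2"
  proof -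
    have "\<epsilon>\<^sup>2 \<le> (\<theta> / 4)\<^sup>2" using \<epsilon> by (intro power_mono) auto
    then have "\<epsilon>\<^sup>2 \<le> \<theta>\<^sup>2 / 16" by (simp add: power_divide)
    moreover have "\<theta>\<^sup>2 / 8 \<le> 1 - cos \<theta>" using \<theta> by (intro one_minus_cos_ge) auto
    moreover have "0 \<le> \<theta>\<^sup>2" by simp
    ultimately show ?thesis by linarith
  qed
  have "\<rho> * (cos \<theta> + \<theta>\<^sup>2 / 50) \<le> \<rho> * (1 - \<epsilon>\<^sup>2)"
    using \<rho> \<theta>2 by (intro mult_left_mono) auto
  also have "\<dots> \<le> h"
  proof -
    \<comment> \<open>The inequality is proved after multiplication by \<rho>: here R \<ge> 1 turns
      \<epsilon>^2 R into at least \<epsilon>^2, and h \<le> \<rho> turns h^2 into at most \<rho>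
      h.\<close>
    have "\<rho> * (\<rho> * (1 - \<epsilon>\<^sup>2)) = R - \<epsilon>\<^sup>2 * R"
      by (simp add: \<rho>(2)[symmetric] algebra_simps power2_eq_square)
    also have "\<dots> \<le> R - \<epsilon>\<^sup>2"
      using R1 mult_left_mono[of 1 R "\<epsilon>\<^sup>2"] by simp
    also have "\<dots> \<le> h * h" using Rh by (simp add: power2_eq_square)
    also have "\<dots> \<le> \<rho> * h" using \<rho> h0 by (intro mult_right_mono) auto
    finally show ?thesis using \<rho>(1) by (simp add: mult_le_cancel_left)
  qed
  finally show "sqrt (\<Sum>i\<in>I. (q i)\<^sup>2) * (cos \<theta> + \<theta>\<^sup>2 / 50) \<le> (\<Sum>i\<in>I. a i * q i)"
    unfolding \<rho>_def R_def h_def .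
qed

text \<open>With p = y^2 the weight is 2 y^(2k), nondecreasing in y. The large interval has length 4
  \<theta> and is bounded by the value at its right end; the small one lies at m \<ge> a, where the
  weight is no smaller up to a constant power. No relation between a and \<theta> is assumed, so
  points near a face of the octant are covered.\<close>

lemma nn_integral_lborel_powr_doubling:
  fixes a m \<theta> \<epsilon> k :: real
  assumes "0 \<le> a" "a \<le> m" "0 < \<theta>" "0 < \<epsilon>" "\<epsilon> \<le> 1" "0 \<le> k"
  shows "(\<integral>\<^sup>+p. indicator {0..} p * (ennreal (p powr (k - 1/2)) * indicator {p. \<bar>sqrt p - a\<bar> \<le> 2 * \<theta>} p) \<partial>lborel)
      \<le> ennreal (8 / \<epsilon> * (4 / \<epsilon>) powr (2 * k)) *
        (\<integral>\<^sup>+p. indicator {0..} p * (ennreal (p powr (k - 1/2)) * indicator {p. m \<le> sqrt p \<and> sqrt p \<le> m + \<epsilon> * \<theta>} p) \<partial>lborel)"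
    (is "?U \<le> _ * ?L")
proof -
  have pw: "2 * y * (y\<^sup>2) powr (k - 1/2) = 2 * y powr (2 * k)" if "0 < y" for y :: real
  proof -
    have "(y\<^sup>2) powr (k - 1/2) = (y powr 2) powr (k - 1/2)"
      using that by (simp add: powr_numeral)
    also have "\<dots> = y powr (2 * k - 1)"
      by (simp add: powr_powr algebra_simps)
    finally show ?thesis
      using that powr_mult_base[of y "2 * k - 1"] by simp
  qed
  have "?U = (\<integral>\<^sup>+y. ennreal (2 * y) * (ennreal ((y\<^sup>2) powr (k - 1/2)) * indicator {p. \<bar>sqrt p - a\<bar> \<le> 2 * \<theta>} (y\<^sup>2)) \<partial>lborel)"
    by (rule nn_integral_lborel_square[symmetric]) measurable
  also have "\<dots> \<le> (\<integral>\<^sup>+y. ennreal (2 * (a + 2 * \<theta>) powr (2 * k)) * indicator {a - 2 * \<theta>..a + 2 * \<theta>} y \<partial>lborel)"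
  proof (rule nn_integral_mono)
    fix y :: real
    show "ennreal (2 * y) * (ennreal ((y\<^sup>2) powr (k - 1/2)) * indicator {p. \<bar>sqrt p - a\<bar> \<le> 2 * \<theta>} (y\<^sup>2))
      \<le> ennreal (2 * (a + 2 * \<theta>) powr (2 * k)) * indicator {a - 2 * \<theta>..a + 2 * \<theta>} y"
    proof (cases "0 < y \<and> \<bar>y - a\<bar> \<le> 2 * \<theta>")
      case True
      then have "y powr (2 * k) \<le> (a + 2 * \<theta>) powr (2 * k)"
        using assms by (intro powr_mono2) auto
      then show ?thesis
        using True by (auto simp: ennreal_mult'[symmetric] pw abs_le_iff intro!: ennreal_leI)
    qed (auto simp: ennreal_neg split: split_indicator)
  qed
  also have "\<dots> = ennreal (8 * \<theta> * (a + 2 * \<theta>) powr (2 * k))"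
    using assms by (simp add: nn_integral_cmult_indicator ennreal_mult'[symmetric])
  also have "\<dots> \<le> ennreal (8 / \<epsilon> * (4 / \<epsilon>) powr (2 * k) * (\<epsilon> * \<theta> * (m + \<epsilon> * \<theta> / 2) powr (2 * k)))"
  proof (rule ennreal_leI)
    \<comment> \<open>The two right ends are comparable: a \<le> m and \<epsilon> \<le> 1 yield a +
      2 \<theta> \<le> (4/\<epsilon>)(m + \<epsilon> \<theta>/2), which accounts for the power of
      4/\<epsilon> in the constant.\<close>
    have "\<epsilon> * a \<le> 1 * a"
      using assms by (intro mult_right_mono) auto
    moreover have "0 \<le> \<epsilon> * \<theta>"
      using assms by simp
    ultimately have "\<epsilon> * (a + 2 * \<theta>) \<le> 4 * (m + \<epsilon> * \<theta> / 2)"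
      using assms(1,2) by (simp add: algebra_simps)
    then have "a + 2 * \<theta> \<le> 4 / \<epsilon> * (m + \<epsilon> * \<theta> / 2)"
      using assms(4) by (simp add: field_simps)
    then have "(a + 2 * \<theta>) powr (2 * k) \<le> (4 / \<epsilon> * (m + \<epsilon> * \<theta> / 2)) powr (2 * k)"
      using assms by (intro powr_mono2) auto
    also have "\<dots> = (4 / \<epsilon>) powr (2 * k) * (m + \<epsilon> * \<theta> / 2) powr (2 * k)"
      by (rule powr_mult)
    finally have "8 * \<theta> * (a + 2 * \<theta>) powr (2 * k) \<le> 8 * \<theta> * ((4 / \<epsilon>) powr (2 * k) * (m + \<epsilon> * \<theta> / 2) powr (2 * k))"
      using assms by (intro mult_left_mono) auto
    then show "8 * \<theta> * (a + 2 * \<theta>) powr (2 * k) \<le> 8 / \<epsilon> * (4 / \<epsilon>) powr (2 * k) * (\<epsilon> * \<theta> * (m + \<epsilon> * \<theta> / 2) powr (2 * k))"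
      using assms(4) by (simp add: field_simps)
  qed
  also have "\<dots> = ennreal (8 / \<epsilon> * (4 / \<epsilon>) powr (2 * k)) * ennreal (\<epsilon> * \<theta> * (m + \<epsilon> * \<theta> / 2) powr (2 * k))"
    using assms by (intro ennreal_mult) auto
  also have "\<dots> \<le> ennreal (8 / \<epsilon> * (4 / \<epsilon>) powr (2 * k)) * ?L"
  proof (rule mult_left_mono)
    \<comment> \<open>Only the upper half of the small interval is kept: m may be 0, where y^(2k)
      degenerates, whereas y \<ge> m + \<epsilon> \<theta>/2 keeps it bounded below.\<close>
    have "ennreal (\<epsilon> * \<theta> * (m + \<epsilon> * \<theta> / 2) powr (2 * k))
      = (\<integral>\<^sup>+y. ennreal (2 * (m + \<epsilon> * \<theta> / 2) powr (2 * k)) * indicator {m + \<epsilon> * \<theta> / 2..m + \<epsilon> * \<theta>} y \<partial>lborel)"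
      using assms by (simp add: nn_integral_cmult_indicator ennreal_mult'[symmetric])
    also have "\<dots> \<le> (\<integral>\<^sup>+y. ennreal (2 * y) * (ennreal ((y\<^sup>2) powr (k - 1/2)) *
        indicator {p. m \<le> sqrt p \<and> sqrt p \<le> m + \<epsilon> * \<theta>} (y\<^sup>2)) \<partial>lborel)"
    proof (rule nn_integral_mono)
      fix y :: real
      show "ennreal (2 * (m + \<epsilon> * \<theta> / 2) powr (2 * k)) * indicator {m + \<epsilon> * \<theta> / 2..m + \<epsilon> * \<theta>} y
        \<le> ennreal (2 * y) * (ennreal ((y\<^sup>2) powr (k - 1/2)) * indicator {p. m \<le> sqrt p \<and> sqrt p \<le> m + \<epsilon> * \<theta>} (y\<^sup>2))"
      proof (cases "m + \<epsilon> * \<theta> / 2 \<le> y \<and> y \<le> m + \<epsilon> * \<theta>")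
        case True
        have pos: "0 < \<epsilon> * \<theta>" using assms by simp
        then have y: "0 < y" "m \<le> y" using True assms(1,2) by linarith+
        have "(m + \<epsilon> * \<theta> / 2) powr (2 * k) \<le> y powr (2 * k)"
          using assms True pos by (intro powr_mono2) auto
        then show ?thesis
          using True y by (auto simp: ennreal_mult'[symmetric] pw intro!: ennreal_leI)
      qed auto
    qed
    also have "\<dots> = ?L"
      by (rule nn_integral_lborel_square) measurable
    finally show "ennreal (\<epsilon> * \<theta> * (m + \<epsilon> * \<theta> / 2) powr (2 * k)) \<le> ?L" .
  qed simp
  finally show ?thesis .
qed

subsection \<open>Homogenization of the simplex weight\<close>

lemma sets_lebd [measurable_cong]: "sets (lebd d) = sets (\<Pi>\<^sub>M i\<in>{..<d}. lborel)"
  by (simp add: lebd_def)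

lemma space_lebd: "space (lebd d) = PiE {..<d} (\<lambda>_. UNIV)"
  by (simp add: lebd_def space_PiM)

lemma measurable_simplexT [measurable]: "simplexT d \<in> sets (lebd d)"
proof -
  have "simplexT d = {x \<in> space (lebd d). (\<forall>i<d. 0 \<le> x i) \<and> (\<Sum>i<d. x i) \<le> 1}"
    by (auto simp: simplexT_def space_lebd)
  also have "\<dots> \<in> sets (lebd d)"
    unfolding lebd_def by measurable
  finally show ?thesis .
qed

lemma measurable_WT [measurable]: "WT \<kappa> d \<in> borel_measurable (lebd d)"
  unfolding lebd_def WT_def by measurable

lemma WT_nonneg: "0 \<le> WT \<kappa> d x"
  unfolding WT_def by (intro mult_nonneg_nonneg prod_nonneg) auto

lemma WT_homogeneous:
  assumes "0 < r" "u \<in> simplexT d"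
  shows "(\<Prod>i<d. (r * u i) powr (\<kappa> i - 1/2)) * (r - (\<Sum>i<d. r * u i)) powr (\<kappa> d - 1/2)
       = r powr (\<Sum>i\<le>d. \<kappa> i - 1/2) * WT \<kappa> d u"
proof -
  have u: "\<forall>i<d. 0 \<le> u i" "(\<Sum>i<d. u i) \<le> 1"
    using assms by (auto simp: simplexT_def)
  have "r - (\<Sum>i<d. r * u i) = r * (1 - (\<Sum>i<d. u i))"
    by (simp add: sum_distrib_left right_diff_distrib)
  then have "(r - (\<Sum>i<d. r * u i)) powr (\<kappa> d - 1/2) = r powr (\<kappa> d - 1/2) * (1 - (\<Sum>i<d. u i)) powr (\<kappa> d - 1/2)"
    using assms u by (simp add: powr_mult)
  moreover have "(\<Prod>i<d. (r * u i) powr (\<kappa> i - 1/2)) = r powr (\<Sum>i<d. \<kappa> i - 1/2) * (\<Prod>i<d. u i powr (\<kappa> i - 1/2))"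
    using assms u by (simp add: powr_mult prod.distrib powr_sum)
  ultimately show ?thesis
    by (simp add: WT_def powr_add lessThan_Suc_atMost[symmetric] mult_ac)
qed

lemma nn_integral_lebd_scale:
  assumes "0 < r" "G \<in> borel_measurable (lebd d)"
  shows "(\<integral>\<^sup>+x. G x \<partial>lebd d) = (\<integral>\<^sup>+u. ennreal (r ^ d) * G (\<lambda>i\<in>{..<d}. r * u i) \<partial>lebd d)"
proof -
  have 1: "(\<integral>\<^sup>+y. ennreal r * g (r * y) \<partial>lborel) = (\<integral>\<^sup>+u. 1 * g u \<partial>lborel)"
    if "g \<in> borel_measurable borel" for g :: "real \<Rightarrow> ennreal"
    using nn_integral_real_affine[OF that, of r 0] assms(1) that
    by (simp add: nn_integral_cmult)
  have "(\<integral>\<^sup>+u. (\<Prod>i\<in>{..<d}. ennreal r) * G (\<lambda>i\<in>{..<d}. r * u i) \<partial>(\<Pi>\<^sub>M i\<in>{..<d}. lborel))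
      = (\<integral>\<^sup>+u. (\<Prod>i\<in>{..<d}. 1) * G u \<partial>(\<Pi>\<^sub>M i\<in>{..<d}. lborel))"
    using assms by (intro nn_integral_PiM_lborel_substitution 1) (auto simp: lebd_def)
  then show ?thesis
    using assms(1) by (simp add: lebd_def prod_constant ennreal_power)
qed

text \<open>Polar coordinates for the 1-norm: r is the sum of the p_i, u the point p/r, and the
  Jacobian is r^d. The radial profile h is free, and its vanishing for r \<le> 0 removes the points
  where p/r makes no sense.\<close>

lemma nn_integral_simplex_cone:
  fixes h :: "real \<Rightarrow> ennreal" and G :: "(nat \<Rightarrow> real) \<Rightarrow> ennreal"
  assumes h[measurable]: "h \<in> borel_measurable borel" and h0: "\<And>r. r \<le> 0 \<Longrightarrow> h r = 0"
    and G[measurable]: "G \<in> borel_measurable (lebd d)"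
  shows "(\<integral>\<^sup>+p. (\<Prod>i\<le>d. indicator {0..} (p i) * ennreal (p i powr (\<kappa> i - 1/2))) *
            (h (\<Sum>i\<le>d. p i) * G (\<lambda>i\<in>{..<d}. p i / (\<Sum>j\<le>d. p j))) \<partial>(\<Pi>\<^sub>M i\<in>{..d}. lborel))
       = (\<integral>\<^sup>+r. h r * ennreal (r powr (\<Sum>i\<le>d. \<kappa> i - 1/2) * r ^ d) \<partial>lborel) *
         (\<integral>\<^sup>+u\<in>simplexT d. ennreal (WT \<kappa> d u) * G u \<partial>lebd d)"
proof -
  interpret product_sigma_finite "\<lambda>_::nat. lborel :: real measure" by (rule product_sigma_finite_lborel)
  interpret L: sigma_finite_measure "lebd d" unfolding lebd_def by (rule sigma_finite) simp
  interpret P: pair_sigma_finite "lebd d" "lborel :: real measure" ..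
  define F where "F p = (\<Prod>i\<le>d. indicator {0..} (p i) * ennreal (p i powr (\<kappa> i - 1/2))) *
            (h (\<Sum>i\<le>d. p i) * G (\<lambda>i\<in>{..<d}. p i / (\<Sum>j\<le>d. p j)))" for p :: "nat \<Rightarrow> real"
  define I where "I = (\<integral>\<^sup>+u\<in>simplexT d. ennreal (WT \<kappa> d u) * G u \<partial>lebd d)"
  have ins: "{..d} = insert d {..<d}" by auto
  note G[unfolded lebd_def, measurable]
  have F[measurable]: "F \<in> borel_measurable (\<Pi>\<^sub>M i\<in>insert d {..<d}. lborel)"
    unfolding F_def ins[symmetric] by measurable
  have Fm[measurable]: "(\<lambda>(x, r). F (x(d := r - (\<Sum>i<d. x i)))) \<in> borel_measurable (lebd d \<Otimes>\<^sub>M lborel)"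
    unfolding lebd_def by measurable
  have F_cone: "ennreal (r ^ d) * F ((\<lambda>i\<in>{..<d}. r * u i)(d := r - (\<Sum>i<d. (\<lambda>i\<in>{..<d}. r * u i) i)))
      = h r * ennreal (r powr (\<Sum>i\<le>d. \<kappa> i - 1/2) * r ^ d) * (ennreal (WT \<kappa> d u) * G u * indicator (simplexT d) u)"
    if r: "0 < r" and u: "u \<in> space (lebd d)" for r u
  proof -
    define p where "p = (\<lambda>i\<in>{..<d}. r * u i)(d := r - (\<Sum>i<d. (\<lambda>i\<in>{..<d}. r * u i) i))"
    have p: "p i = r * u i" if "i < d" for i using that by (simp add: p_def)
    have pd: "p d = r - (\<Sum>i<d. r * u i)" by (simp add: p_def)
    then have pd': "p d = r * (1 - (\<Sum>i<d. u i))" by (simp add: sum_distrib_left right_diff_distrib)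
    have "(\<Sum>i<d. p i) = (\<Sum>i<d. r * u i)" by (rule sum.cong) (auto simp: p)
    then have sum_p: "(\<Sum>i\<le>d. p i) = r"
      by (simp only: lessThan_Suc_atMost[symmetric] sum.lessThan_Suc pd)
    have res: "(\<lambda>i\<in>{..<d}. p i / r) = u"
    proof
      fix i show "(\<lambda>i\<in>{..<d}. p i / r) i = u i"
        using r u p[of i] by (cases "i < d") (auto simp: space_lebd PiE_def extensional_def)
    qed
    have prd: "(\<Prod>i\<le>d. indicator {0..} (p i) * ennreal (p i powr (\<kappa> i - 1/2)))
        = ennreal (r powr (\<Sum>i\<le>d. \<kappa> i - 1/2) * WT \<kappa> d u) * indicator (simplexT d) u"
    proof (cases "u \<in> simplexT d")
      case True
      have nn: "0 \<le> p i" if "i \<le> d" for i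
      proof (cases "i = d")
        case True
        then show ?thesis using r \<open>u \<in> simplexT d\<close> pd' by (simp add: simplexT_def)
      next
        case False
        then show ?thesis using r \<open>u \<in> simplexT d\<close> p[of i] that by (simp add: simplexT_def)
      qed
      have "(\<Prod>i\<le>d. indicator {0..} (p i) * ennreal (p i powr (\<kappa> i - 1/2))) = (\<Prod>i\<le>d. ennreal (p i powr (\<kappa> i - 1/2)))"
        by (rule prod.cong) (use nn in auto)
      also have "\<dots> = ennreal (\<Prod>i\<le>d. p i powr (\<kappa> i - 1/2))"
        by (rule prod_ennreal) simp
      also have "(\<Prod>i\<le>d. p i powr (\<kappa> i - 1/2)) = (\<Prod>i<d. p i powr (\<kappa> i - 1/2)) * p d powr (\<kappa> d - 1/2)"
        by (simp only: lessThan_Suc_atMost[symmetric] prod.lessThan_Suc)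
      also have "\<dots> = (\<Prod>i<d. (r * u i) powr (\<kappa> i - 1/2)) * (r - (\<Sum>i<d. r * u i)) powr (\<kappa> d - 1/2)"
        unfolding pd by (intro arg_cong2[of _ _ _ _ "(*)"] prod.cong refl) (simp add: p)
      also have "\<dots> = r powr (\<Sum>i\<le>d. \<kappa> i - 1/2) * WT \<kappa> d u"
        by (rule WT_homogeneous[OF r True])
      finally show ?thesis using True by simp
    next
      case False
      \<comment> \<open>Outside the simplex either some u_i is negative or their sum exceeds 1. In
        both cases a coordinate of p is negative and the indicators of {0..} annihilate the
        product.\<close>
      have "\<exists>i\<le>d. p i < 0"
      proof (cases "\<exists>i<d. u i < 0")
        case True
        then obtain i where i: "i < d" "u i < 0" by blast
        then have "p i < 0" using r by (simp add: p mult_less_0_iff)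
        then show ?thesis using i(1) less_imp_le by blast
      next
        case nn: False
        then have "\<forall>i<d. 0 \<le> u i" by (meson not_less)
        then have "1 < (\<Sum>i<d. u i)"
          using u False unfolding simplexT_def space_lebd not_le[symmetric] by blast
        then have "p d < 0" using r unfolding pd' by (simp add: mult_less_0_iff)
        then show ?thesis by blast
      qed
      then obtain i where "i \<le> d" "p i < 0" by blast
      then have "(\<Prod>i\<le>d. indicator {0..} (p i) * ennreal (p i powr (\<kappa> i - 1/2))) = 0"
        by (intro prod_zero bexI[of _ i]) auto
      then show ?thesis using False by simp
    qed
    have "F p = ennreal (r powr (\<Sum>i\<le>d. \<kappa> i - 1/2) * WT \<kappa> d u) * indicator (simplexT d) u * (h r * G u)"
      unfolding F_def sum_p prd res ..
    also have "ennreal (r ^ d) * \<dots> = h r * ennreal (r powr (\<Sum>i\<le>d. \<kappa> i - 1/2) * r ^ d) * (ennreal (WT \<kappa> d u) * G u * indicator (simplexT d) u)"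
    proof -
      have "ennreal (r powr (\<Sum>i\<le>d. \<kappa> i - 1/2) * WT \<kappa> d u) = ennreal (r powr (\<Sum>i\<le>d. \<kappa> i - 1/2)) * ennreal (WT \<kappa> d u)"
        by (rule ennreal_mult) (auto simp: WT_nonneg)
      moreover have "ennreal (r powr (\<Sum>i\<le>d. \<kappa> i - 1/2) * r ^ d) = ennreal (r powr (\<Sum>i\<le>d. \<kappa> i - 1/2)) * ennreal (r ^ d)"
        using r by (intro ennreal_mult) auto
      ultimately show ?thesis by (simp only: mult_ac)
    qed
    finally show ?thesis unfolding p_def[symmetric] .
  qed
  have "(\<integral>\<^sup>+p. F p \<partial>(\<Pi>\<^sub>M i\<in>{..d}. lborel)) = (\<integral>\<^sup>+x. \<integral>\<^sup>+y. F (x(d := y)) \<partial>lborel \<partial>lebd d)"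
    unfolding ins lebd_def by (rule product_nn_integral_insert) auto
  \<comment> \<open>For fixed first d coordinates, translating the last one makes it the total r.
    After Fubini the remaining coordinates are scaled by r, which produces r^d.\<close>
  also have "\<dots> = (\<integral>\<^sup>+x. \<integral>\<^sup>+r. F (x(d := r - (\<Sum>i<d. x i))) \<partial>lborel \<partial>lebd d)"
  proof (rule nn_integral_cong)
    fix x assume "x \<in> space (lebd d)"
    then have [measurable]: "(\<lambda>y. F (x(d := y))) \<in> borel_measurable borel"
      unfolding lebd_def by measurable
    show "(\<integral>\<^sup>+y. F (x(d := y)) \<partial>lborel) = (\<integral>\<^sup>+r. F (x(d := r - (\<Sum>i<d. x i))) \<partial>lborel)"
      using nn_integral_real_affine[of "\<lambda>y. F (x(d := y))" 1 "- (\<Sum>i<d. x i)"] by simp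
  qed
  also have "\<dots> = (\<integral>\<^sup>+r. \<integral>\<^sup>+x. F (x(d := r - (\<Sum>i<d. x i))) \<partial>lebd d \<partial>lborel)"
    by (rule P.Fubini'[symmetric]) measurable
  also have "\<dots> = (\<integral>\<^sup>+r. h r * ennreal (r powr (\<Sum>i\<le>d. \<kappa> i - 1/2) * r ^ d) * I \<partial>lborel)"
  proof (rule nn_integral_cong)
    fix r :: real
    show "(\<integral>\<^sup>+x. F (x(d := r - (\<Sum>i<d. x i))) \<partial>lebd d) = h r * ennreal (r powr (\<Sum>i\<le>d. \<kappa> i - 1/2) * r ^ d) * I"
    proof (cases "0 < r")
      case True
      have "(\<integral>\<^sup>+x. F (x(d := r - (\<Sum>i<d. x i))) \<partial>lebd d)
          = (\<integral>\<^sup>+u. h r * ennreal (r powr (\<Sum>i\<le>d. \<kappa> i - 1/2) * r ^ d) * (ennreal (WT \<kappa> d u) * G u * indicator (simplexT d) u) \<partial>lebd d)"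
        apply (subst nn_integral_lebd_scale[OF True])
         apply measurable
        apply (rule nn_integral_cong)
        apply (erule F_cone[OF True])
        done
      also have "\<dots> = h r * ennreal (r powr (\<Sum>i\<le>d. \<kappa> i - 1/2) * r ^ d) * I"
        unfolding I_def by (rule nn_integral_cmult) measurable
      finally show ?thesis .
    next
      case False
      have "F (x(d := r - (\<Sum>i<d. x i))) = 0" for x
      proof -
        have "(\<Sum>i\<le>d. (x(d := r - (\<Sum>i<d. x i))) i) = r"
          by (simp add: lessThan_Suc_atMost[symmetric])
        then show ?thesis unfolding F_def using False h0[of r] by simp
      qed
      then show ?thesis using False h0[of r] by simp
    qed
  qed
  also have "\<dots> = (\<integral>\<^sup>+r. h r * ennreal (r powr (\<Sum>i\<le>d. \<kappa> i - 1/2) * r ^ d) \<partial>lborel) * I"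
    by (rule nn_integral_multc) measurable
  finally show ?thesis unfolding F_def I_def .
qed

subsection \<open>Doubling of caps\<close>

text \<open>The square-root coordinates that identify the simplex with the positive octant of the unit
  sphere in one more dimension; d_T is the angle between the images.\<close>
definition octant :: "nat \<Rightarrow> (nat \<Rightarrow> real) \<Rightarrow> nat \<Rightarrow> real" where
  "octant d u i = (if i < d then sqrt (u i) else sqrt (1 - (\<Sum>j<d. u j)))"

text \<open>Indexed by a threshold for the inner product and not by an angle, so that cos \<theta> +
  \<theta>^2/50 can be used directly.\<close>

definition capT :: "nat \<Rightarrow> (nat \<Rightarrow> real) \<Rightarrow> real \<Rightarrow> (nat \<Rightarrow> real) set" where
  "capT d x \<tau> = {u \<in> simplexT d. \<tau> \<le> (\<Sum>i\<le>d. octant d x i * octant d u i)}"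

lemma octant_nonneg: "u \<in> simplexT d \<Longrightarrow> 0 \<le> octant d u i"
  by (auto simp: octant_def simplexT_def)

lemma sum_octant_squares: "u \<in> simplexT d \<Longrightarrow> (\<Sum>i\<le>d. (octant d u i)\<^sup>2) = 1"
  by (simp add: lessThan_Suc_atMost[symmetric] octant_def simplexT_def)

lemma dT_octant: "dT d x y = arccos (\<Sum>i\<le>d. octant d x i * octant d y i)"
  by (simp add: lessThan_Suc_atMost[symmetric] octant_def dT_def real_sqrt_mult)

lemma sum_octant_mult_bounds:
  assumes "x \<in> simplexT d" "u \<in> simplexT d"
  shows "0 \<le> (\<Sum>i\<le>d. octant d x i * octant d u i)" "(\<Sum>i\<le>d. octant d x i * octant d u i) \<le> 1"
proof -
  show "0 \<le> (\<Sum>i\<le>d. octant d x i * octant d u i)"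
    using assms by (intro sum_nonneg mult_nonneg_nonneg octant_nonneg)
  have "0 \<le> (\<Sum>i\<le>d. (octant d x i - octant d u i)\<^sup>2)" by (simp add: sum_nonneg)
  also have "\<dots> = 2 - 2 * (\<Sum>i\<le>d. octant d x i * octant d u i)"
    using assms by (simp add: power2_diff sum.distrib sum_subtractf sum_octant_squares
        sum_distrib_left mult_ac)
  finally show "(\<Sum>i\<le>d. octant d x i * octant d u i) \<le> 1" by simp
qed

text \<open>\<open>arccos\<close> is decreasing on [-1, 1]; the bounds 0 and 1 on the inner product
  keep its argument there.\<close>

lemma dT_le_iff_capT:
  assumes "x \<in> simplexT d" "0 \<le> \<theta>" "\<theta> \<le> pi"
  shows "{u \<in> simplexT d. dT d x u \<le> \<theta>} = capT d x (cos \<theta>)"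
proof -
  have "dT d x u \<le> \<theta> \<longleftrightarrow> cos \<theta> \<le> (\<Sum>i\<le>d. octant d x i * octant d u i)"
    if "u \<in> simplexT d" for u
    using sum_octant_mult_bounds[OF assms(1) that] assms(2,3)
      arccos_le_mono[of "\<Sum>i\<le>d. octant d x i * octant d u i" "cos \<theta>"]
    unfolding dT_octant by (simp add: arccos_cos)
  then show ?thesis by (auto simp: capT_def)
qed

lemma measurable_octant [measurable]: "i \<le> d \<Longrightarrow> (\<lambda>u. octant d u i) \<in> borel_measurable (lebd d)"
  unfolding octant_def lebd_def by (cases "i < d") (simp_all, measurable)

lemma measurable_capT [measurable]: "capT d x \<tau> \<in> sets (lebd d)"
proof -
  have "capT d x \<tau> = simplexT d \<inter> {u \<in> space (lebd d). \<tau> \<le> (\<Sum>i\<le>d. octant d x i * octant d u i)}"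
    by (auto simp: capT_def simplexT_def space_lebd)
  also have "\<dots> \<in> sets (lebd d)"
    by measurable
  finally show ?thesis .
qed

text \<open>Division by the sum of the p_i is radial projection to the unit sphere in the
  coordinates sqrt (p_i).\<close>

lemma octant_normalize:
  assumes p: "\<And>i. i \<le> d \<Longrightarrow> 0 \<le> p i" and r: "0 < (\<Sum>j\<le>d. p j)"
  defines "u \<equiv> (\<lambda>i\<in>{..<d}. p i / (\<Sum>j\<le>d. p j))"
  shows "u \<in> simplexT d" and "i \<le> d \<Longrightarrow> octant d u i = sqrt (p i) / sqrt (\<Sum>j\<le>d. p j)"
proof -
  define r where "r = (\<Sum>j\<le>d. p j)"
  have sum_p: "(\<Sum>j<d. p j) = r - p d"
    by (simp add: r_def lessThan_Suc_atMost[symmetric])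
  have "(\<Sum>i<d. u i) = (\<Sum>i<d. p i / r)"
    by (intro sum.cong) (auto simp: u_def r_def)
  then have sum_u: "1 - (\<Sum>i<d. u i) = p d / r"
    using r by (simp add: sum_divide_distrib[symmetric] sum_p r_def[symmetric] diff_divide_distrib)
  have "0 \<le> p d / r"
    using p[of d] r by (simp add: r_def)
  then have "(\<Sum>i<d. u i) \<le> 1" using sum_u by linarith
  moreover have "0 \<le> u i" if "i < d" for i
    using p[of i] r that by (simp add: u_def)
  moreover have "u \<in> PiE {..<d} (\<lambda>_. UNIV)" by (simp add: u_def)
  ultimately show "u \<in> simplexT d" by (simp add: simplexT_def)
  show "octant d u i = sqrt (p i) / sqrt (\<Sum>j\<le>d. p j)" if "i \<le> d"
  proof (cases "i < d")
    case True
    then show ?thesis by (simp add: octant_def u_def real_sqrt_divide)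
  next
    case False
    then have "i = d" using that by simp
    then show ?thesis by (simp add: octant_def sum_u real_sqrt_divide r_def)
  qed
qed

text \<open>sqrt (p_i) is \<rho> times a unit vector coordinate. One \<theta> bounds the radial
  error \<rho> - 1, the other the coordinate distance within the cap.\<close>

lemma cone_section_subset_box:
  assumes x: "x \<in> simplexT d" and \<theta>: "0 < \<theta>"
    and p: "\<And>i. i \<le> d \<Longrightarrow> 0 \<le> p i"
    and r: "1 \<le> (\<Sum>j\<le>d. p j)" "(\<Sum>j\<le>d. p j) \<le> (1 + \<theta>)\<^sup>2"
    and cap: "(\<lambda>i\<in>{..<d}. p i / (\<Sum>j\<le>d. p j)) \<in> capT d x (cos \<theta>)"
    and i: "i \<le> d"
  shows "\<bar>sqrt (p i) - octant d x i\<bar> \<le> 2 * \<theta>"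
proof -
  define \<rho> where "\<rho> = sqrt (\<Sum>j\<le>d. p j)"
  define u where "u = (\<lambda>i\<in>{..<d}. p i / (\<Sum>j\<le>d. p j))"
  have \<rho>: "1 \<le> \<rho>" "\<rho> \<le> 1 + \<theta>"
    using r \<theta> by (auto simp: \<rho>_def real_le_lsqrt)
  have u: "u \<in> simplexT d" "octant d u i = sqrt (p i) / \<rho>"
    using octant_normalize[of d p] p r i by (auto simp: u_def \<rho>_def)
  have near: "\<bar>octant d u i - octant d x i\<bar> \<le> \<theta>"
    using cap \<theta> i u x unfolding u_def[symmetric]
    by (intro unit_vectors_component_dist_le[where I = "{..d}"]) (auto simp: sum_octant_squares capT_def)
  have "(octant d u i)\<^sup>2 \<le> 1"
    unfolding sum_octant_squares[OF u(1), symmetric] using i by (intro member_le_sum) auto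
  then have "octant d u i \<le> 1" using power2_le_imp_le[of "octant d u i" 1] by simp
  moreover have "0 \<le> octant d u i" using u(1) by (rule octant_nonneg)
  ultimately have "(\<rho> - 1) * octant d u i \<le> \<theta> * 1" and "0 \<le> (\<rho> - 1) * octant d u i"
    using \<rho> \<theta> by (intro mult_mono mult_nonneg_nonneg; simp)+
  moreover have "sqrt (p i) - octant d u i = (\<rho> - 1) * octant d u i"
    using u(2) \<rho> by (simp add: field_simps)
  ultimately show ?thesis using near by linarith
qed

text \<open>The d + 1 offsets, each at most \<theta>/(4(d + 1)), add up to at most \<theta>/4, which
  is what \<open>perturbed_ray_in_cone\<close> tolerates. The box starts at (1 + \<theta>/2) a and
  extends only in nonnegative directions.\<close>

lemma box_subset_cone_section:
  assumes x: "x \<in> simplexT d" and \<theta>: "0 < \<theta>" "\<theta> \<le> pi"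
    and p: "\<And>i. i \<le> d \<Longrightarrow> 0 \<le> p i"
    and box: "\<And>i. i \<le> d \<Longrightarrow> (1 + \<theta> / 2) * octant d x i \<le> sqrt (p i)"
      "\<And>i. i \<le> d \<Longrightarrow> sqrt (p i) \<le> (1 + \<theta> / 2) * octant d x i + 1 / (4 * (real d + 1)) * \<theta>"
  shows "1 \<le> (\<Sum>j\<le>d. p j)" and "(\<Sum>j\<le>d. p j) \<le> (1 + \<theta>)\<^sup>2"
    and "(\<lambda>i\<in>{..<d}. p i / (\<Sum>j\<le>d. p j)) \<in> capT d x (cos \<theta> + \<theta>\<^sup>2 / 50)"
proof -
  define e where "e i = sqrt (p i) - (1 + \<theta> / 2) * octant d x i" for i
  have e: "0 \<le> e i" "e i \<le> 1 / (4 * (real d + 1)) * \<theta>" if "i \<le> d" for i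
    using box[OF that] by (auto simp: e_def)
  have "(\<Sum>i\<le>d. e i) \<le> (\<Sum>i\<le>d. 1 / (4 * (real d + 1)) * \<theta>)"
    using e by (intro sum_mono) auto
  also have "\<dots> = \<theta> / 4"
    by (simp add: divide_simps)
  finally have sum_e: "(\<Sum>i\<le>d. e i) \<le> \<theta> / 4" .
  have q: "(1 + \<theta> / 2) * octant d x i + e i = sqrt (p i)" for i
    by (simp add: e_def)
  note ray = perturbed_ray_in_cone[where I = "{..d}" and a = "octant d x" and e = e, OF finite_atMost
      sum_octant_squares[OF x] octant_nonneg[OF x] e(1) sum_e \<theta>, unfolded q]
  have sum_p: "(\<Sum>i\<le>d. (sqrt (p i))\<^sup>2) = (\<Sum>j\<le>d. p j)"
    using p by (intro sum.cong) auto
  show 1: "1 \<le> (\<Sum>j\<le>d. p j)" and "(\<Sum>j\<le>d. p j) \<le> (1 + \<theta>)\<^sup>2"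
    using ray(1,2) by (auto simp: sum_p)
  define \<rho> where "\<rho> = sqrt (\<Sum>j\<le>d. p j)"
  define u where "u = (\<lambda>i\<in>{..<d}. p i / (\<Sum>j\<le>d. p j))"
  have \<rho>: "1 \<le> \<rho>" using 1 by (simp add: \<rho>_def)
  have u: "u \<in> simplexT d" "\<And>i. i \<le> d \<Longrightarrow> octant d u i = sqrt (p i) / \<rho>"
    using octant_normalize[of d p] p 1 by (auto simp: u_def \<rho>_def)
  have "\<rho> * (cos \<theta> + \<theta>\<^sup>2 / 50) \<le> (\<Sum>i\<le>d. octant d x i * sqrt (p i))"
    using ray(3) by (simp add: sum_p \<rho>_def)
  also have "\<dots> = \<rho> * (\<Sum>i\<le>d. octant d x i * octant d u i)"
    unfolding sum_distrib_left using u(2) \<rho> by (intro sum.cong) auto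
  finally have "cos \<theta> + \<theta>\<^sup>2 / 50 \<le> (\<Sum>i\<le>d. octant d x i * octant d u i)"
    using \<rho> by (simp add: mult_le_cancel_left)
  then show "(\<lambda>i\<in>{..<d}. p i / (\<Sum>j\<le>d. p j)) \<in> capT d x (cos \<theta> + \<theta>\<^sup>2 / 50)"
    using u(1) unfolding u_def capT_def by simp
qed

text \<open>Each cap integral times the same radial integral J is an integral over a truncated cone.
  The large cone lies in the box of the U i, the small one contains the box of the L i, and box
  integrals factor into one-dimensional ones. At the end J is cancelled, so it has to be neither 0
  nor infinite.\<close>

lemma capT_doubling:
  assumes d: "1 \<le> d" and \<kappa>: "\<And>i. i \<le> d \<Longrightarrow> 0 \<le> \<kappa> i"
  obtains C where "0 < C" and "\<And>x \<theta>. x \<in> simplexT d \<Longrightarrow> 0 < \<theta> \<Longrightarrow> \<theta> \<le> pi \<Longrightarrow>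
      (\<integral>\<^sup>+u\<in>capT d x (cos \<theta>). ennreal (WT \<kappa> d u) \<partial>lebd d)
    \<le> ennreal C * (\<integral>\<^sup>+u\<in>capT d x (cos \<theta> + \<theta>\<^sup>2 / 50). ennreal (WT \<kappa> d u) \<partial>lebd d)"
proof
  interpret product_sigma_finite "\<lambda>_::nat. lborel :: real measure" by (rule product_sigma_finite_lborel)
  define \<epsilon> where "\<epsilon> = 1 / (4 * (real d + 1))"
  have \<epsilon>: "0 < \<epsilon>" "\<epsilon> \<le> 1" by (auto simp: \<epsilon>_def field_simps)
  define c where "c i = 8 / \<epsilon> * (4 / \<epsilon>) powr (2 * \<kappa> i)" for i
  have c: "0 < c i" for i using \<epsilon> by (simp add: c_def)
  show "0 < (\<Prod>i\<le>d. c i)" using c by (simp add: prod_pos)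
  fix x and \<theta> :: real
  assume x: "x \<in> simplexT d" and \<theta>: "0 < \<theta>" "\<theta> \<le> pi"
  define a where "a = octant d x"
  define w where "w i p = indicator {0..} p * ennreal (p powr (\<kappa> i - 1/2))" for i and p :: real
  have [measurable]: "w i \<in> borel_measurable borel" for i unfolding w_def by measurable
  \<comment> \<open>The argument of h is the sum of the p_i, the square of the radius in square-root
    coordinates; hence the square of 1 + \<theta>.\<close>
  define h :: "real \<Rightarrow> ennreal" where "h = indicator {1..(1 + \<theta>)\<^sup>2}"
  define s where "s = (\<Sum>i\<le>d. \<kappa> i - 1/2)"
  define J where "J = (\<integral>\<^sup>+r. h r * ennreal (r powr s * r ^ d) \<partial>lborel)"
  define U where "U i = {p. \<bar>sqrt p - a i\<bar> \<le> 2 * \<theta>}" for i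
  define L where "L i = {p. (1 + \<theta> / 2) * a i \<le> sqrt p \<and> sqrt p \<le> (1 + \<theta> / 2) * a i + \<epsilon> * \<theta>}" for i
  have [measurable]: "U i \<in> sets borel" "L i \<in> sets borel" for i unfolding U_def L_def by measurable
  define K where "K \<tau> = (\<integral>\<^sup>+p. (\<Prod>i\<le>d. w i (p i)) * (h (\<Sum>i\<le>d. p i) *
      indicator (capT d x \<tau>) (\<lambda>i\<in>{..<d}. p i / (\<Sum>j\<le>d. p j))) \<partial>(\<Pi>\<^sub>M i\<in>{..d}. lborel))" for \<tau>
  have K: "K \<tau> = J * (\<integral>\<^sup>+u\<in>capT d x \<tau>. ennreal (WT \<kappa> d u) \<partial>lebd d)" for \<tau>
  proof -
    have "K \<tau> = J * (\<integral>\<^sup>+u\<in>simplexT d. ennreal (WT \<kappa> d u) * indicator (capT d x \<tau>) u \<partial>lebd d)"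
      unfolding K_def J_def w_def s_def
      by (rule nn_integral_simplex_cone) (auto simp: h_def)
    also have "(\<integral>\<^sup>+u\<in>simplexT d. ennreal (WT \<kappa> d u) * indicator (capT d x \<tau>) u \<partial>lebd d)
      = (\<integral>\<^sup>+u\<in>capT d x \<tau>. ennreal (WT \<kappa> d u) \<partial>lebd d)"
      by (intro nn_integral_cong) (auto simp: capT_def split: split_indicator)
    finally show ?thesis .
  qed
  have w0: "(\<Prod>i\<le>d. w i (p i)) = 0" if "\<not> (\<forall>i\<le>d. 0 \<le> p i)" for p
  proof -
    from that obtain i where "i \<le> d" "p i < 0" by (auto simp: not_le)
    then show ?thesis by (intro prod_zero bexI[of _ i]) (auto simp: w_def)
  qed
  have "K (cos \<theta>) \<le> (\<integral>\<^sup>+p. (\<Prod>i\<le>d. w i (p i) * indicator (U i) (p i)) \<partial>(\<Pi>\<^sub>M i\<in>{..d}. lborel))"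
    unfolding K_def
  proof (rule nn_integral_mono)
    fix p :: "nat \<Rightarrow> real"
    show "(\<Prod>i\<le>d. w i (p i)) * (h (\<Sum>i\<le>d. p i) * indicator (capT d x (cos \<theta>)) (\<lambda>i\<in>{..<d}. p i / (\<Sum>j\<le>d. p j)))
      \<le> (\<Prod>i\<le>d. w i (p i) * indicator (U i) (p i))"
    proof (cases "(\<forall>i\<le>d. 0 \<le> p i) \<and> (\<Sum>j\<le>d. p j) \<in> {1..(1 + \<theta>)\<^sup>2} \<and>
        (\<lambda>i\<in>{..<d}. p i / (\<Sum>j\<le>d. p j)) \<in> capT d x (cos \<theta>)")
      case True
      then have "p i \<in> U i" if "i \<le> d" for i
        using cone_section_subset_box[OF x \<theta>(1), of p i] that by (auto simp: U_def a_def)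
      then have "(\<Prod>i\<le>d. w i (p i) * indicator (U i) (p i)) = (\<Prod>i\<le>d. w i (p i))"
        by (intro prod.cong) auto
      then show ?thesis using True by (simp add: h_def)
    next
      case out: False
      show ?thesis
      proof (cases "\<forall>i\<le>d. 0 \<le> p i")
        case True
        then show ?thesis using out by (auto simp: h_def split: split_indicator)
      next
        case False
        then show ?thesis unfolding w0[OF False] by simp
      qed
    qed
  qed
  also have "\<dots> = (\<Prod>i\<le>d. \<integral>\<^sup>+p. w i p * indicator (U i) p \<partial>lborel)"
    by (rule product_nn_integral_prod) auto
  also have "\<dots> \<le> (\<Prod>i\<le>d. ennreal (c i) * (\<integral>\<^sup>+p. w i p * indicator (L i) p \<partial>lborel))"
  proof (rule prod_mono_ennreal)
    fix i assume "i \<in> {..d}"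
    then have i: "i \<le> d" by simp
    have "0 \<le> a i" using x by (simp add: a_def octant_nonneg)
    moreover have "1 * a i \<le> (1 + \<theta> / 2) * a i"
      using \<open>0 \<le> a i\<close> \<theta> by (intro mult_right_mono) auto
    ultimately show "(\<integral>\<^sup>+p. w i p * indicator (U i) p \<partial>lborel)
      \<le> ennreal (c i) * (\<integral>\<^sup>+p. w i p * indicator (L i) p \<partial>lborel)"
      using nn_integral_lborel_powr_doubling[of "a i" "(1 + \<theta> / 2) * a i" \<theta> \<epsilon> "\<kappa> i"] \<theta> \<epsilon> \<kappa>[OF i]
      by (simp add: w_def U_def L_def c_def mult.assoc)
  qed
  also have "\<dots> = ennreal (\<Prod>i\<le>d. c i) * (\<Prod>i\<le>d. \<integral>\<^sup>+p. w i p * indicator (L i) p \<partial>lborel)"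
    using c by (simp add: prod.distrib prod_ennreal less_imp_le)
  also have "(\<Prod>i\<le>d. \<integral>\<^sup>+p. w i p * indicator (L i) p \<partial>lborel)
      = (\<integral>\<^sup>+p. (\<Prod>i\<le>d. w i (p i) * indicator (L i) (p i)) \<partial>(\<Pi>\<^sub>M i\<in>{..d}. lborel))"
    by (rule product_nn_integral_prod[symmetric]) auto
  also have "ennreal (\<Prod>i\<le>d. c i) * \<dots> \<le> ennreal (\<Prod>i\<le>d. c i) * K (cos \<theta> + \<theta>\<^sup>2 / 50)"
    unfolding K_def
  proof (intro mult_left_mono nn_integral_mono)
    fix p :: "nat \<Rightarrow> real"
    show "(\<Prod>i\<le>d. w i (p i) * indicator (L i) (p i)) \<le> (\<Prod>i\<le>d. w i (p i)) *
        (h (\<Sum>i\<le>d. p i) * indicator (capT d x (cos \<theta> + \<theta>\<^sup>2 / 50)) (\<lambda>i\<in>{..<d}. p i / (\<Sum>j\<le>d. p j)))"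
    proof (cases "\<forall>i\<le>d. 0 \<le> p i \<and> p i \<in> L i")
      case True
      then have "1 \<le> (\<Sum>j\<le>d. p j)" "(\<Sum>j\<le>d. p j) \<le> (1 + \<theta>)\<^sup>2"
        "(\<lambda>i\<in>{..<d}. p i / (\<Sum>j\<le>d. p j)) \<in> capT d x (cos \<theta> + \<theta>\<^sup>2 / 50)"
        using box_subset_cone_section[OF x \<theta>, of p] by (auto simp: L_def a_def \<epsilon>_def)
      moreover have "(\<Prod>i\<le>d. w i (p i) * indicator (L i) (p i)) = (\<Prod>i\<le>d. w i (p i))"
        using True by (intro prod.cong) auto
      ultimately show ?thesis by (simp add: h_def)
    next
      case False
      then obtain i where "i \<le> d" "w i (p i) * indicator (L i) (p i) = 0"
        by (auto simp: w_def)
      then have 0: "(\<Prod>i\<le>d. w i (p i) * indicator (L i) (p i)) = 0"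
        by (intro prod_zero bexI[of _ i]) auto
      show ?thesis unfolding 0 by simp
    qed
  qed simp
  finally have "K (cos \<theta>) \<le> ennreal (\<Prod>i\<le>d. c i) * K (cos \<theta> + \<theta>\<^sup>2 / 50)" .
  then have le: "J * (\<integral>\<^sup>+u\<in>capT d x (cos \<theta>). ennreal (WT \<kappa> d u) \<partial>lebd d)
      \<le> J * (ennreal (\<Prod>i\<le>d. c i) * (\<integral>\<^sup>+u\<in>capT d x (cos \<theta> + \<theta>\<^sup>2 / 50). ennreal (WT \<kappa> d u) \<partial>lebd d))"
    unfolding K by (simp only: mult_ac)
  \<comment> \<open>s + d is the sum of the \<kappa>_i plus (d - 1)/2. Being nonnegative, it makes
    the radial density at least 1 and nondecreasing for r \<ge> 1, which bounds J from both
    sides.\<close>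
  have sd: "0 \<le> s + d"
  proof -
    have "s = (\<Sum>i\<le>d. \<kappa> i) - (real d + 1) / 2"
      by (simp add: s_def sum_subtractf)
    moreover have "0 \<le> (\<Sum>i\<le>d. \<kappa> i)" using \<kappa> by (auto intro: sum_nonneg)
    moreover have "1 \<le> real d" using d by simp
    ultimately show ?thesis by (simp add: field_simps)
  qed
  have pw: "r powr s * r ^ d = r powr (s + d)" if "1 \<le> r" for r
    using that by (simp add: powr_add powr_realpow)
  have \<theta>1: "1 < (1 + \<theta>)\<^sup>2" using \<theta> by (simp add: power2_eq_square algebra_simps add_pos_pos)
  have "J \<noteq> 0"
  proof -
    have "0 < ennreal ((1 + \<theta>)\<^sup>2 - 1)" using \<theta>1 by simp
    also have "\<dots> = (\<integral>\<^sup>+r. h r \<partial>lborel)"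
      using \<theta>1 by (simp add: h_def)
    also have "\<dots> \<le> J"
      unfolding J_def
    proof (rule nn_integral_mono)
      fix r
      show "h r \<le> h r * ennreal (r powr s * r ^ d)"
        using sd pw[of r] ge_one_powr_ge_zero[of r "s + d"]
        by (auto simp: h_def split: split_indicator)
    qed
    finally show ?thesis by simp
  qed
  moreover have "J \<noteq> top"
  proof -
    have "J \<le> (\<integral>\<^sup>+r. ennreal (((1 + \<theta>)\<^sup>2) powr (s + d)) * h r \<partial>lborel)"
      unfolding J_def
    proof (rule nn_integral_mono)
      fix r
      show "h r * ennreal (r powr s * r ^ d) \<le> ennreal (((1 + \<theta>)\<^sup>2) powr (s + d)) * h r"
        using sd pw[of r] powr_mono2[of "s + d" r "(1 + \<theta>)\<^sup>2"]
        by (auto simp: h_def ennreal_leI split: split_indicator)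
    qed
    also have "\<dots> = ennreal (((1 + \<theta>)\<^sup>2) powr (s + d)) * ennreal ((1 + \<theta>)\<^sup>2 - 1)"
      unfolding h_def using \<theta>1 by (subst nn_integral_cmult_indicator) auto
    also have "\<dots> < top" by (simp add: ennreal_mult_less_top)
    finally show ?thesis by simp
  qed
  ultimately show "(\<integral>\<^sup>+u\<in>capT d x (cos \<theta>). ennreal (WT \<kappa> d u) \<partial>lebd d)
      \<le> ennreal (\<Prod>i\<le>d. c i) * (\<integral>\<^sup>+u\<in>capT d x (cos \<theta> + \<theta>\<^sup>2 / 50). ennreal (WT \<kappa> d u) \<partial>lebd d)"
    using le by (simp add: ennreal_mult_le_mult_iff)
qed

subsection \<open>Bounds for V on caps\<close>

text \<open>If a \<le> 2 \<theta>, then \<theta>/(a + \<theta>) is at least 1/3 and the factor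
  3^(2k) makes the bound exceed 1. Otherwise |z| is at least a/2, the constraint forces 1 - |t|
  \<le> (\<theta>/a)^2, and the tail estimate applies.\<close>

lemma emeasure_kmeas_cap_upper:
  assumes k: "0 \<le> k"
  shows "\<exists>C>0. \<forall>a z \<theta>. 0 \<le> a \<and> 0 < \<theta> \<and> \<bar>\<bar>z\<bar> - a\<bar> \<le> \<theta> \<longrightarrow>
    emeasure (kmeas k) {t. a * \<bar>z\<bar> * (1 - \<bar>t\<bar>) \<le> \<theta>\<^sup>2 / 2} \<le> ennreal (C * (\<theta> / (a + \<theta>)) powr (2 * k))"
proof -
  interpret prob_space "kmeas k" by (rule prob_space_kmeas) fact
  obtain C where C: "0 < C"
    "\<And>u. 0 < u \<Longrightarrow> u \<le> 1 \<Longrightarrow> emeasure (kmeas k) {t. 1 - u \<le> \<bar>t\<bar>} \<le> ennreal (C * u powr k)"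
    using emeasure_kmeas_upper[OF k] by auto
  have le: "emeasure (kmeas k) {t. a * \<bar>z\<bar> * (1 - \<bar>t\<bar>) \<le> \<theta>\<^sup>2 / 2}
      \<le> ennreal (max 1 C * 3 powr (2 * k) * (\<theta> / (a + \<theta>)) powr (2 * k))"
    if a: "0 \<le> a" and \<theta>: "0 < \<theta>" and z: "\<bar>\<bar>z\<bar> - a\<bar> \<le> \<theta>" for a z \<theta>
  proof -
    have eq: "3 powr (2 * k) * (\<theta> / (a + \<theta>)) powr (2 * k) = (3 * (\<theta> / (a + \<theta>))) powr (2 * k)"
      by (rule powr_mult[symmetric])
    show ?thesis
    proof (cases "a \<le> 2 * \<theta>")
      case True
      have "1 \<le> 3 * (\<theta> / (a + \<theta>))"
        using True a \<theta> by (simp add: field_simps)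
      then have "1 \<le> 3 powr (2 * k) * (\<theta> / (a + \<theta>)) powr (2 * k)"
        unfolding eq using k by (intro ge_one_powr_ge_zero) auto
      then have "1 * 1 \<le> max 1 C * (3 powr (2 * k) * (\<theta> / (a + \<theta>)) powr (2 * k))"
        by (intro mult_mono) auto
      then have "1 \<le> max 1 C * 3 powr (2 * k) * (\<theta> / (a + \<theta>)) powr (2 * k)"
        by (simp only: mult_1 mult.assoc)
      then have "1 \<le> ennreal (max 1 C * 3 powr (2 * k) * (\<theta> / (a + \<theta>)) powr (2 * k))"
        using ennreal_leI by fastforce
      moreover have "emeasure (kmeas k) {t. a * \<bar>z\<bar> * (1 - \<bar>t\<bar>) \<le> \<theta>\<^sup>2 / 2} \<le> 1"
        using emeasure_space[of "kmeas k"] emeasure_space_1 by simp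
      ultimately show ?thesis by (rule order_trans[rotated])
    next
      case False
      define u where "u = (\<theta> / a)\<^sup>2"
      have pos: "0 < a" using False \<theta> by simp
      have "\<theta> / a \<le> 1" using False \<theta> pos by simp
      then have u: "0 < u" "u \<le> 1" using pos \<theta> by (auto simp: u_def power_le_one)
      have "{t. a * \<bar>z\<bar> * (1 - \<bar>t\<bar>) \<le> \<theta>\<^sup>2 / 2} \<subseteq> {t. 1 - u \<le> \<bar>t\<bar>}"
      proof safe
        fix t assume t: "a * \<bar>z\<bar> * (1 - \<bar>t\<bar>) \<le> \<theta>\<^sup>2 / 2"
        show "1 - u \<le> \<bar>t\<bar>"
        proof (cases "\<bar>t\<bar> \<le> 1")
          case True
          have "a / 2 \<le> \<bar>z\<bar>" using z False by linarith
          then have "a * (a / 2) * (1 - \<bar>t\<bar>) \<le> a * \<bar>z\<bar> * (1 - \<bar>t\<bar>)"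
            using pos True by (intro mult_right_mono mult_left_mono) auto
          also note t
          finally have "1 - \<bar>t\<bar> \<le> u"
            using pos by (simp add: u_def power_divide field_simps power2_eq_square)
          then show ?thesis by simp
        qed (use u in auto)
      qed
      then have "emeasure (kmeas k) {t. a * \<bar>z\<bar> * (1 - \<bar>t\<bar>) \<le> \<theta>\<^sup>2 / 2} \<le> emeasure (kmeas k) {t. 1 - u \<le> \<bar>t\<bar>}"
        by (intro emeasure_mono) auto
      also have "\<dots> \<le> ennreal (C * u powr k)" using u by (rule C(2))
      also have "\<dots> \<le> ennreal (max 1 C * 3 powr (2 * k) * (\<theta> / (a + \<theta>)) powr (2 * k))"
      proof (rule ennreal_leI)
        have "u powr k = (\<theta> / a) powr (2 * k)"
          using pos \<theta> by (simp add: u_def powr_powr[symmetric] powr_numeral)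
        also have "\<dots> \<le> (3 * (\<theta> / (a + \<theta>))) powr (2 * k)"
          using k pos \<theta> False by (intro powr_mono2) (auto simp: field_simps)
        finally have "C * u powr k \<le> max 1 C * (3 powr (2 * k) * (\<theta> / (a + \<theta>)) powr (2 * k))"
          unfolding eq using C(1) by (intro mult_mono) auto
        then show "C * u powr k \<le> max 1 C * 3 powr (2 * k) * (\<theta> / (a + \<theta>)) powr (2 * k)"
          by (simp only: mult.assoc)
      qed
      finally show ?thesis .
    qed
  qed
  show ?thesis
    using le by (intro exI[of _ "max 1 C * 3 powr (2 * k)"]) auto
qed

text \<open>The width is chosen so that, for z at most a + \<theta>, the loss a z (1 - t) over this
  interval is at most \<eta> \<theta>^2. The factor \<eta>^k goes into the constant.\<close>

lemma emeasure_kmeas_cap_lower: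
  fixes k \<eta> :: real
  assumes k: "0 \<le> k" and \<eta>: "0 < \<eta>" "\<eta> \<le> 1"
  shows "\<exists>c>0. \<forall>a \<theta>. 0 \<le> a \<and> 0 < \<theta> \<longrightarrow>
    ennreal (c * (\<theta> / (a + \<theta>)) powr (2 * k)) \<le> emeasure (kmeas k) {1 - \<eta> * (\<theta> / (a + \<theta>))\<^sup>2..1}"
proof -
  obtain c where c: "0 < c"
    "\<And>u. 0 < u \<Longrightarrow> u \<le> 1 \<Longrightarrow> ennreal (c * u powr k) \<le> emeasure (kmeas k) {1 - u..1}"
    using emeasure_kmeas_lower[OF k] by auto
  have "ennreal (c * \<eta> powr k * (\<theta> / (a + \<theta>)) powr (2 * k)) \<le> emeasure (kmeas k) {1 - \<eta> * (\<theta> / (a + \<theta>))\<^sup>2..1}"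
    if a: "0 \<le> a" and \<theta>: "0 < \<theta>" for a \<theta>
  proof -
    define s where "s = \<theta> / (a + \<theta>)"
    have s: "0 < s" "s \<le> 1" using a \<theta> by (auto simp: s_def)
    have "0 < \<eta> * s\<^sup>2" "\<eta> * s\<^sup>2 \<le> 1"
      using s \<eta> by (auto intro!: mult_le_one power_le_one)
    then have "ennreal (c * (\<eta> * s\<^sup>2) powr k) \<le> emeasure (kmeas k) {1 - \<eta> * s\<^sup>2..1}"
      by (rule c(2))
    moreover have "(\<eta> * s\<^sup>2) powr k = \<eta> powr k * s powr (2 * k)"
      using s by (simp add: powr_mult powr_powr[symmetric] powr_numeral)
    ultimately show ?thesis by (simp add: s_def mult.assoc)
  qed
  then show ?thesis
    using c(1) \<eta> by (intro exI[of _ "c * \<eta> powr k"]) auto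
qed

definition capK :: "(nat \<Rightarrow> real) \<Rightarrow> nat \<Rightarrow> (nat \<Rightarrow> real) \<Rightarrow> real \<Rightarrow> real" where
  "capK \<kappa> d x \<theta> = (\<Prod>i\<le>d. (\<theta> / (octant d x i + \<theta>)) powr (2 * \<kappa> i))"

lemma capK_pos:
  assumes "x \<in> simplexT d" "0 < \<theta>"
  shows "0 < capK \<kappa> d x \<theta>"
  unfolding capK_def using assms octant_nonneg[OF assms(1)]
  by (intro prod_pos) (simp add: add_nonneg_pos less_imp_neq[symmetric])

lemma capE_octant:
  assumes "x \<in> simplexT d"
  shows "capE d (\<lambda>i\<in>{..<d}. sqrt (x i)) \<theta> = {w \<in> PiE {..d} (\<lambda>_. UNIV).
    (\<Sum>i\<le>d. (w i)\<^sup>2) \<le> 1 \<and> cos \<theta> \<le> (\<Sum>i\<le>d. octant d x i * w i) \<and> 0 \<le> w d}"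
proof -
  have "(\<Sum>i<d. ((\<lambda>i\<in>{..<d}. sqrt (x i)) i)\<^sup>2) = (\<Sum>i<d. x i)"
    using assms by (intro sum.cong) (auto simp: simplexT_def)
  then show ?thesis
    by (simp add: capE_def octant_def lessThan_Suc_atMost[symmetric])
qed

text \<open>The t_i are independent under a probability measure, so V of an indicator is a
  probability and boxes in t have product probability. This turns both bounds for V into inclusions
  between A and boxes.\<close>

lemma Vk_indicator:
  fixes d :: nat and z :: "nat \<Rightarrow> real" and \<theta> :: real
  assumes \<kappa>: "\<forall>i\<le>d. 0 \<le> \<kappa> i" and x: "x \<in> simplexT d"
  defines "P \<equiv> \<Pi>\<^sub>M i\<in>{..d}. kmeas (\<kappa> i)"
  defines "A \<equiv> {t \<in> space P. (\<Sum>i\<le>d. (z i * t i)\<^sup>2) \<le> 1 \<and>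
      cos \<theta> \<le> (\<Sum>i\<le>d. octant d x i * (z i * t i)) \<and> 0 \<le> z d * t d}"
  shows "prob_space P" and "A \<in> sets P"
    and "\<And>B. (\<And>i. i \<le> d \<Longrightarrow> B i \<in> sets borel) \<Longrightarrow> emeasure P (PiE {..d} B) = (\<Prod>i\<le>d. emeasure (kmeas (\<kappa> i)) (B i))"
    and "ennreal (Vk \<kappa> d (indicator (capE d (\<lambda>i\<in>{..<d}. sqrt (x i)) \<theta>)) z) = emeasure P A"
proof -
  \<comment> \<open>The locale demands a probability measure at every index, but \<kappa> is known
    to be nonnegative only up to d.\<close>
  define M where "M i = kmeas (max 0 (\<kappa> i))" for i
  have M: "prob_space (M i)" for i
    unfolding M_def by (rule prob_space_kmeas) simp
  interpret product_prob_space M "{..d}"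
    by (simp add: product_prob_space_def product_prob_space_axioms_def product_sigma_finite_def M
        prob_space_imp_sigma_finite)
  have P: "P = PiM {..d} M"
    unfolding P_def M_def using \<kappa> by (intro PiM_cong) auto
  show prob: "prob_space P"
    unfolding P by (rule prob_space_PiM) (rule M)
  then interpret prob_space P .
  show A: "A \<in> sets P"
    unfolding A_def P_def by measurable
  show "emeasure P (PiE {..d} B) = (\<Prod>i\<le>d. emeasure (kmeas (\<kappa> i)) (B i))"
    if "\<And>i. i \<le> d \<Longrightarrow> B i \<in> sets borel" for B
  proof -
    have "emeasure P (PiE {..d} B) = (\<Prod>i\<le>d. emeasure (M i) (B i))"
      unfolding P by (rule emeasure_PiM) (use that in \<open>auto simp: M_def\<close>)
    also have "\<dots> = (\<Prod>i\<le>d. emeasure (kmeas (\<kappa> i)) (B i))"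
      using \<kappa> by (intro prod.cong) (auto simp: M_def)
    finally show ?thesis .
  qed
  have "Vk \<kappa> d (indicator (capE d (\<lambda>i\<in>{..<d}. sqrt (x i)) \<theta>)) z = (\<integral>t. indicator A t \<partial>P)"
    unfolding Vk_def P_def[symmetric] capE_octant[OF x]
    by (intro Bochner_Integration.integral_cong refl) (auto simp: A_def split: split_indicator)
  also have "\<dots> = measure P A"
    using A by simp
  finally show "ennreal (Vk \<kappa> d (indicator (capE d (\<lambda>i\<in>{..<d}. sqrt (x i)) \<theta>)) z) = emeasure P A"
    by (simp add: emeasure_eq_measure)
qed

text \<open>For t in A the total loss, the sum of a_i |z_i| (1 - |t_i|), is at most the inner
  product of a and |z| minus cos \<theta>, hence at most \<theta>^2/2. All terms are nonnegative, so
  each obeys this bound and t lies in a box. A negative right-hand side leaves no t at all.\<close>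

lemma Vk_cap_upper:
  fixes d :: nat
  assumes \<kappa>: "\<forall>i\<le>d. 0 \<le> \<kappa> i"
  obtains C where "0 < C" and "\<And>x \<theta> z. x \<in> simplexT d \<Longrightarrow> 0 < \<theta> \<Longrightarrow> (\<Sum>i\<le>d. (z i)\<^sup>2) = 1 \<Longrightarrow>
    Vk \<kappa> d (indicator (capE d (\<lambda>i\<in>{..<d}. sqrt (x i)) \<theta>)) z
    \<le> C * capK \<kappa> d x \<theta> * (if cos \<theta> \<le> (\<Sum>i\<le>d. octant d x i * \<bar>z i\<bar>) then 1 else 0)"
proof -
  have "\<forall>i. \<exists>C>0. i \<le> d \<longrightarrow> (\<forall>a z \<theta>. 0 \<le> a \<and> 0 < \<theta> \<and> \<bar>\<bar>z\<bar> - a\<bar> \<le> \<theta> \<longrightarrow>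
    emeasure (kmeas (\<kappa> i)) {t. a * \<bar>z\<bar> * (1 - \<bar>t\<bar>) \<le> \<theta>\<^sup>2 / 2} \<le> ennreal (C * (\<theta> / (a + \<theta>)) powr (2 * \<kappa> i)))"
    using emeasure_kmeas_cap_upper \<kappa> by (meson zero_less_one)
  then obtain C where C: "\<And>i. 0 < C i"
    "\<And>i a z \<theta>. i \<le> d \<Longrightarrow> 0 \<le> a \<Longrightarrow> 0 < \<theta> \<Longrightarrow> \<bar>\<bar>z\<bar> - a\<bar> \<le> \<theta> \<Longrightarrow>
    emeasure (kmeas (\<kappa> i)) {t. a * \<bar>z\<bar> * (1 - \<bar>t\<bar>) \<le> \<theta>\<^sup>2 / 2} \<le> ennreal (C i * (\<theta> / (a + \<theta>)) powr (2 * \<kappa> i))"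
    by metis
  have C0: "0 < (\<Prod>i\<le>d. C i)" using C(1) by (simp add: prod_pos)
  have "Vk \<kappa> d (indicator (capE d (\<lambda>i\<in>{..<d}. sqrt (x i)) \<theta>)) z
    \<le> (\<Prod>i\<le>d. C i) * capK \<kappa> d x \<theta> * (if cos \<theta> \<le> (\<Sum>i\<le>d. octant d x i * \<bar>z i\<bar>) then 1 else 0)"
    if x: "x \<in> simplexT d" and \<theta>: "0 < \<theta>" and z: "(\<Sum>i\<le>d. (z i)\<^sup>2) = 1" for x \<theta> z
  proof -
    define a where "a = octant d x"
    define P where "P = (\<Pi>\<^sub>M i\<in>{..d}. kmeas (\<kappa> i))"
    define A where "A = {t \<in> space P. (\<Sum>i\<le>d. (z i * t i)\<^sup>2) \<le> 1 \<and>
      cos \<theta> \<le> (\<Sum>i\<le>d. octant d x i * (z i * t i)) \<and> 0 \<le> z d * t d}"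
    note prob = Vk_indicator(1)[OF \<kappa> x, folded P_def]
    note box = Vk_indicator(3)[OF \<kappa> x, folded P_def]
    note setA = Vk_indicator(2)[where z = z and \<theta> = \<theta>, OF \<kappa> x, folded P_def, folded A_def]
    note Vk = Vk_indicator(4)[where z = z and \<theta> = \<theta>, OF \<kappa> x, folded P_def, folded A_def]
    interpret prob_space P by (rule prob)
    have a: "0 \<le> a i" for i using x by (simp add: a_def octant_nonneg)
    have a1: "(\<Sum>i\<le>d. (a i)\<^sup>2) = 1" unfolding a_def using x by (rule sum_octant_squares)
    have ae: "AE t in P. \<forall>i\<in>{..d}. \<bar>t i\<bar> \<le> 1"
      unfolding P_def
      by (intro AE_finite_allI AE_PiM_component prob_space_kmeas AE_kmeas_abs_le_1) (use \<kappa> in auto)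
    have bound: "a j * \<bar>z j\<bar> * (1 - \<bar>t j\<bar>) \<le> (\<Sum>i\<le>d. a i * \<bar>z i\<bar>) - cos \<theta>"
      if t: "t \<in> A" "\<forall>i\<in>{..d}. \<bar>t i\<bar> \<le> 1" and j: "j \<le> d" for t j
    proof -
      have nn: "0 \<le> a i * \<bar>z i\<bar> * (1 - \<bar>t i\<bar>)" if "i \<le> d" for i
        using a t(2) that by (intro mult_nonneg_nonneg) auto
      have "a j * \<bar>z j\<bar> * (1 - \<bar>t j\<bar>) \<le> (\<Sum>i\<le>d. a i * \<bar>z i\<bar> * (1 - \<bar>t i\<bar>))"
        using j nn by (intro member_le_sum) auto
      also have "\<dots> = (\<Sum>i\<le>d. a i * \<bar>z i\<bar>) - (\<Sum>i\<le>d. a i * \<bar>z i * t i\<bar>)"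
        by (simp add: algebra_simps sum_subtractf abs_mult)
      also have "(\<Sum>i\<le>d. a i * (z i * t i)) \<le> (\<Sum>i\<le>d. a i * \<bar>z i * t i\<bar>)"
        using a by (intro sum_mono mult_left_mono) auto
      then have "(\<Sum>i\<le>d. a i * \<bar>z i\<bar>) - (\<Sum>i\<le>d. a i * \<bar>z i * t i\<bar>) \<le> (\<Sum>i\<le>d. a i * \<bar>z i\<bar>) - cos \<theta>"
        using t(1) by (auto simp: A_def a_def)
      finally show ?thesis .
    qed
    show ?thesis
    proof (cases "cos \<theta> \<le> (\<Sum>i\<le>d. a i * \<bar>z i\<bar>)")
      case True
      have near: "\<bar>\<bar>z j\<bar> - a j\<bar> \<le> \<theta>" if "j \<le> d" for j
        by (rule unit_vectors_component_dist_le[OF _ a1 _ True])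
          (use z \<theta> that in auto)
      have s1: "(\<Sum>i\<le>d. a i * \<bar>z i\<bar>) \<le> 1"
      proof -
        have "0 \<le> (\<Sum>i\<le>d. (a i - \<bar>z i\<bar>)\<^sup>2)" by (simp add: sum_nonneg)
        also have "\<dots> = 2 - 2 * (\<Sum>i\<le>d. a i * \<bar>z i\<bar>)"
          using a1 z by (simp add: power2_diff sum.distrib sum_subtractf sum_distrib_left mult_ac)
        finally show ?thesis by simp
      qed
      define B where "B i = {t. a i * \<bar>z i\<bar> * (1 - \<bar>t\<bar>) \<le> \<theta>\<^sup>2 / 2}" for i
      have [measurable]: "B i \<in> sets borel" for i unfolding B_def by measurable
      have PB: "PiE {..d} B \<in> sets P"
        unfolding P_def by (intro sets_PiM_I_finite) auto
      have "emeasure P A \<le> emeasure P (PiE {..d} B)"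
      \<comment> \<open>The inclusion holds only almost everywhere, since |t_i| \<le> 1 is a
        property of the support of \<open>kmeas\<close>.\<close>
      proof (rule emeasure_mono_AE[OF _ PB])
        show "AE t in P. t \<in> A \<longrightarrow> t \<in> PiE {..d} B"
          using ae
        proof eventually_elim
          fix t :: "nat \<Rightarrow> real" assume t: "\<forall>i\<in>{..d}. \<bar>t i\<bar> \<le> 1"
          show "t \<in> A \<longrightarrow> t \<in> PiE {..d} B"
          proof
            assume tA: "t \<in> A"
            have "t i \<in> B i" if "i \<le> d" for i
              using bound[OF tA t that] s1 one_minus_cos_le[of \<theta>] by (auto simp: B_def)
            then show "t \<in> PiE {..d} B"
              using tA by (auto simp: A_def P_def space_PiM PiE_def)
          qed
        qed
      qed
      also have "\<dots> = (\<Prod>i\<le>d. emeasure (kmeas (\<kappa> i)) (B i))"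
        by (rule box) auto
      also have "\<dots> \<le> (\<Prod>i\<le>d. ennreal (C i * (\<theta> / (a i + \<theta>)) powr (2 * \<kappa> i)))"
        unfolding B_def using C(2) a \<theta> near by (intro prod_mono_ennreal) auto
      also have "\<dots> = ennreal (\<Prod>i\<le>d. C i * (\<theta> / (a i + \<theta>)) powr (2 * \<kappa> i))"
        using C(1) by (intro prod_ennreal) (auto simp: less_imp_le)
      also have "(\<Prod>i\<le>d. C i * (\<theta> / (a i + \<theta>)) powr (2 * \<kappa> i)) = (\<Prod>i\<le>d. C i) * capK \<kappa> d x \<theta>"
        by (simp add: prod.distrib capK_def a_def)
      finally have "ennreal (Vk \<kappa> d (indicator (capE d (\<lambda>i\<in>{..<d}. sqrt (x i)) \<theta>)) z)
          \<le> ennreal ((\<Prod>i\<le>d. C i) * capK \<kappa> d x \<theta>)"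
        unfolding Vk .
      then show ?thesis
        using True C0 capK_pos[OF x \<theta>, of \<kappa>] by (simp add: a_def ennreal_le_iff)
    next
      case False
      have "emeasure P A = emeasure P {}"
      proof (rule emeasure_eq_AE[OF _ setA])
        show "AE t in P. t \<in> A \<longleftrightarrow> t \<in> {}"
          using ae
        proof eventually_elim
          fix t :: "nat \<Rightarrow> real" assume t: "\<forall>i\<in>{..d}. \<bar>t i\<bar> \<le> 1"
          show "t \<in> A \<longleftrightarrow> t \<in> {}"
          proof safe
            assume "t \<in> A"
            \<comment> \<open>Any index would do: one nonnegative term below a negative number is a
              contradiction.\<close>
            moreover have "0 \<le> a 0 * \<bar>z 0\<bar> * (1 - \<bar>t 0\<bar>)"
              using a t by (intro mult_nonneg_nonneg) auto
            ultimately show "t \<in> {}" using bound[of t 0] t False by auto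
          qed
        qed
      qed auto
      then have "ennreal (Vk \<kappa> d (indicator (capE d (\<lambda>i\<in>{..<d}. sqrt (x i)) \<theta>)) z) = 0"
        unfolding Vk by simp
      \<comment> \<open>\<open>ennreal\<close> being 0 says only that V is at most 0, which is the
        required bound.\<close>
      then show ?thesis using False by (simp add: a_def ennreal_eq_0_iff)
    qed
  qed
  with C0 show ?thesis by (rule that)
qed

text \<open>Every t in a box at the corner (1, ..., 1) satisfies the cap constraint, as its total
  loss stays within the slack \<theta>^2/50. Its coordinates lie in [0, 1], so multiplication by
  them preserves the norm bound and the sign of the last coordinate.\<close>

lemma Vk_cap_lower:
  fixes d :: nat
  assumes \<kappa>: "\<forall>i\<le>d. 0 \<le> \<kappa> i"
  obtains c where "0 < c" and "\<And>x \<theta> z. x \<in> simplexT d \<Longrightarrow> 0 < \<theta> \<Longrightarrow> (\<Sum>i\<le>d. (z i)\<^sup>2) = 1 \<Longrightarrow>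
    (\<And>i. i \<le> d \<Longrightarrow> 0 \<le> z i) \<Longrightarrow> cos \<theta> + \<theta>\<^sup>2 / 50 \<le> (\<Sum>i\<le>d. octant d x i * z i) \<Longrightarrow>
    c * capK \<kappa> d x \<theta> \<le> Vk \<kappa> d (indicator (capE d (\<lambda>i\<in>{..<d}. sqrt (x i)) \<theta>)) z"
proof -
  \<comment> \<open>The slack \<theta>^2/50 is shared equally among d + 1 coordinates.\<close>
  define \<eta> where "\<eta> = 1 / (50 * (real d + 1))"
  have \<eta>: "0 < \<eta>" "\<eta> \<le> 1" by (auto simp: \<eta>_def field_simps)
  have "\<forall>i. \<exists>c>0. i \<le> d \<longrightarrow> (\<forall>a \<theta>. 0 \<le> a \<and> 0 < \<theta> \<longrightarrow>
    ennreal (c * (\<theta> / (a + \<theta>)) powr (2 * \<kappa> i)) \<le> emeasure (kmeas (\<kappa> i)) {1 - \<eta> * (\<theta> / (a + \<theta>))\<^sup>2..1})"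
    using emeasure_kmeas_cap_lower[OF _ \<eta>] \<kappa> by (meson zero_less_one)
  then obtain c where c: "\<And>i. 0 < c i"
    "\<And>i a \<theta>. i \<le> d \<Longrightarrow> 0 \<le> a \<Longrightarrow> 0 < \<theta> \<Longrightarrow>
    ennreal (c i * (\<theta> / (a + \<theta>)) powr (2 * \<kappa> i)) \<le> emeasure (kmeas (\<kappa> i)) {1 - \<eta> * (\<theta> / (a + \<theta>))\<^sup>2..1}"
    by metis
  have c0: "0 < (\<Prod>i\<le>d. c i)" using c(1) by (simp add: prod_pos)
  have "(\<Prod>i\<le>d. c i) * capK \<kappa> d x \<theta> \<le> Vk \<kappa> d (indicator (capE d (\<lambda>i\<in>{..<d}. sqrt (x i)) \<theta>)) z"
    if x: "x \<in> simplexT d" and \<theta>: "0 < \<theta>" and z: "(\<Sum>i\<le>d. (z i)\<^sup>2) = 1" "\<And>i. i \<le> d \<Longrightarrow> 0 \<le> z i"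
      and cap: "cos \<theta> + \<theta>\<^sup>2 / 50 \<le> (\<Sum>i\<le>d. octant d x i * z i)" for x \<theta> z
  proof -
    define a where "a = octant d x"
    define P where "P = (\<Pi>\<^sub>M i\<in>{..d}. kmeas (\<kappa> i))"
    define A where "A = {t \<in> space P. (\<Sum>i\<le>d. (z i * t i)\<^sup>2) \<le> 1 \<and>
      cos \<theta> \<le> (\<Sum>i\<le>d. octant d x i * (z i * t i)) \<and> 0 \<le> z d * t d}"
    note prob = Vk_indicator(1)[OF \<kappa> x, folded P_def]
    note box = Vk_indicator(3)[OF \<kappa> x, folded P_def]
    note setA = Vk_indicator(2)[where z = z and \<theta> = \<theta>, OF \<kappa> x, folded P_def, folded A_def]
    note Vk = Vk_indicator(4)[where z = z and \<theta> = \<theta>, OF \<kappa> x, folded P_def, folded A_def]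
    interpret prob_space P by (rule prob)
    have a: "0 \<le> a i" for i using x by (simp add: a_def octant_nonneg)
    have a1: "(\<Sum>i\<le>d. (a i)\<^sup>2) = 1" unfolding a_def using x by (rule sum_octant_squares)
    have near: "\<bar>z j - a j\<bar> \<le> \<theta>" if "j \<le> d" for j
    proof (rule unit_vectors_component_dist_le[OF _ a1 z(1)])
      show "cos \<theta> \<le> (\<Sum>i\<le>d. a i * z i)"
        using cap zero_le_power2[of \<theta>] unfolding a_def by linarith
    qed (use \<theta> that in auto)
    define B where "B i = {1 - \<eta> * (\<theta> / (a i + \<theta>))\<^sup>2..1}" for i
    have B: "0 \<le> t" "t \<le> 1" "a i * z i * (1 - t) \<le> \<eta> * \<theta>\<^sup>2" if "t \<in> B i" "i \<le> d" for t i
    proof -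
      have pos: "0 < a i + \<theta>" using a[of i] \<theta> by simp
      have "(\<theta> / (a i + \<theta>))\<^sup>2 \<le> 1"
        using a[of i] \<theta> by (intro power_le_one) auto
      then have "\<eta> * (\<theta> / (a i + \<theta>))\<^sup>2 \<le> 1"
        using \<eta> by (intro mult_le_one) auto
      then show t: "0 \<le> t" "t \<le> 1" using that by (auto simp: B_def)
      \<comment> \<open>Both a_i and z_i are at most a_i + \<theta>, so the square cancels the
        denominator in the width of B i.\<close>
      have "a i * z i * (1 - t) \<le> (a i + \<theta>)\<^sup>2 * (\<eta> * (\<theta> / (a i + \<theta>))\<^sup>2)"
      proof (rule mult_mono)
        show "a i * z i \<le> (a i + \<theta>)\<^sup>2"
          unfolding power2_eq_square using near[OF \<open>i \<le> d\<close>] a[of i] \<theta> z(2)[OF \<open>i \<le> d\<close>]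
          by (intro mult_mono) auto
      qed (use that t in \<open>auto simp: B_def\<close>)
      also have "\<dots> = \<eta> * \<theta>\<^sup>2"
        using pos by (simp add: power_divide)
      finally show "a i * z i * (1 - t) \<le> \<eta> * \<theta>\<^sup>2" .
    qed
    have "PiE {..d} B \<subseteq> A"
    proof
      fix t assume "t \<in> PiE {..d} B"
      then have t: "\<And>i. i \<le> d \<Longrightarrow> t i \<in> B i" and "t \<in> space P"
        by (auto simp: P_def space_PiM PiE_def)
      have "(\<Sum>i\<le>d. (z i * t i)\<^sup>2) \<le> (\<Sum>i\<le>d. (z i)\<^sup>2)"
        using z(2) B(1,2)[OF t] by (intro sum_mono power_mono) (auto intro: mult_left_le)
      moreover have "cos \<theta> \<le> (\<Sum>i\<le>d. a i * (z i * t i))"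
      proof -
        have "(\<Sum>i\<le>d. a i * z i) - (\<Sum>i\<le>d. a i * (z i * t i)) = (\<Sum>i\<le>d. a i * z i * (1 - t i))"
          by (simp add: algebra_simps sum_subtractf)
        also have "\<dots> \<le> (\<Sum>i\<le>d. \<eta> * \<theta>\<^sup>2)"
          using B(3)[OF t] by (intro sum_mono) auto
        also have "\<dots> = \<theta>\<^sup>2 / 50"
          by (simp add: \<eta>_def divide_simps)
        finally show ?thesis using cap unfolding a_def by linarith
      qed
      moreover have "0 \<le> z d * t d" using z(2)[of d] B(1)[OF t, of d] by simp
      ultimately show "t \<in> A"
        using z(1) \<open>t \<in> space P\<close> by (simp add: A_def a_def)
    qed
    then have "emeasure P (PiE {..d} B) \<le> emeasure P A"
      by (intro emeasure_mono setA)
    moreover have "emeasure P (PiE {..d} B) = (\<Prod>i\<le>d. emeasure (kmeas (\<kappa> i)) (B i))"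
      by (rule box) (simp add: B_def)
    moreover have "(\<Prod>i\<le>d. ennreal (c i * (\<theta> / (a i + \<theta>)) powr (2 * \<kappa> i))) \<le> (\<Prod>i\<le>d. emeasure (kmeas (\<kappa> i)) (B i))"
      unfolding B_def using c(2) a \<theta> by (intro prod_mono_ennreal) auto
    moreover have "(\<Prod>i\<le>d. ennreal (c i * (\<theta> / (a i + \<theta>)) powr (2 * \<kappa> i)))
        = ennreal (\<Prod>i\<le>d. c i * (\<theta> / (a i + \<theta>)) powr (2 * \<kappa> i))"
      using c(1) by (intro prod_ennreal) (auto simp: less_imp_le)
    moreover have "(\<Prod>i\<le>d. c i * (\<theta> / (a i + \<theta>)) powr (2 * \<kappa> i)) = (\<Prod>i\<le>d. c i) * capK \<kappa> d x \<theta>"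
      by (simp add: prod.distrib capK_def a_def)
    ultimately have "ennreal ((\<Prod>i\<le>d. c i) * capK \<kappa> d x \<theta>)
        \<le> ennreal (Vk \<kappa> d (indicator (capE d (\<lambda>i\<in>{..<d}. sqrt (x i)) \<theta>)) z)"
      unfolding Vk by simp
    moreover have "0 \<le> Vk \<kappa> d (indicator (capE d (\<lambda>i\<in>{..<d}. sqrt (x i)) \<theta>)) z"
      unfolding Vk_def by (rule Bochner_Integration.integral_nonneg) simp
    ultimately show ?thesis by (simp add: ennreal_le_iff)
  qed
  with c0 show ?thesis by (rule that)
qed

section \<open>Transfer between the ball and the simplex\<close>

lemma WB_eq_WT_psi: "WB \<kappa> d y = WT \<kappa> d (psi d y) * (\<Prod>i<d. \<bar>y i\<bar>)"
proof -
  \<comment> \<open>At t = 0 both sides are 0 for every k, including k = 0, because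
    \<open>0 powr 0\<close> is 0.\<close>
  have pw: "\<bar>t\<bar> powr (2 * k) = (t\<^sup>2) powr (k - 1/2) * \<bar>t\<bar>" for t k :: real
  proof (cases "t = 0")
    case False
    have "(t\<^sup>2) powr (k - 1/2) = (\<bar>t\<bar> powr 2) powr (k - 1/2)"
      using False by (simp add: powr_numeral)
    also have "\<dots> = \<bar>t\<bar> powr (2 * k - 1)"
      unfolding powr_powr by (simp add: algebra_simps)
    finally show ?thesis
      using False powr_mult_base[of "\<bar>t\<bar>" "2 * k - 1"] by (simp add: mult.commute)
  qed simp
  have "(\<Prod>i<d. \<bar>y i\<bar> powr (2 * \<kappa> i)) = (\<Prod>i<d. psi d y i powr (\<kappa> i - 1/2)) * (\<Prod>i<d. \<bar>y i\<bar>)"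
    unfolding prod.distrib[symmetric] by (intro prod.cong) (auto simp: psi_def pw)
  then show ?thesis
    by (simp add: WB_def WT_def psi_def mult_ac)
qed

lemma ballB_iff_psi: "y \<in> space (lebd d) \<Longrightarrow> y \<in> ballB d \<longleftrightarrow> psi d y \<in> simplexT d"
  by (auto simp: ballB_def simplexT_def psi_def space_lebd)

lemma octant_psi:
  assumes "y \<in> ballB d" "i \<le> d"
  shows "octant d (psi d y) i = \<bar>liftY d y i\<bar>"
  using assms by (auto simp: octant_def psi_def liftY_def ballB_def)

text \<open>The weight |y_i| sees all 2^d orthants and serves the upper bound. The weight
  \<open>ennreal (2 * y i)\<close> vanishes for negative y_i and sees the positive orthant alone,
  where the lower bound for V is available.\<close>

lemma nn_integral_lebd_psi:
  assumes G: "G \<in> borel_measurable (lebd d)"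
  shows "(\<integral>\<^sup>+y. (\<Prod>i<d. ennreal \<bar>y i\<bar>) * G (psi d y) \<partial>lebd d) = (\<integral>\<^sup>+u. (\<Prod>i<d. indicator {0..} (u i)) * G u \<partial>lebd d)"
    and "(\<integral>\<^sup>+y. (\<Prod>i<d. ennreal (2 * y i)) * G (psi d y) \<partial>lebd d) = (\<integral>\<^sup>+u. (\<Prod>i<d. indicator {0..} (u i)) * G u \<partial>lebd d)"
proof -
  show "(\<integral>\<^sup>+y. (\<Prod>i<d. ennreal \<bar>y i\<bar>) * G (psi d y) \<partial>lebd d) = (\<integral>\<^sup>+u. (\<Prod>i<d. indicator {0..} (u i)) * G u \<partial>lebd d)"
    unfolding lebd_def psi_def
    by (rule nn_integral_PiM_lborel_substitution[where w = "\<lambda>_ y. ennreal \<bar>y\<bar>" and v = "\<lambda>_. indicator {0..}" and T = "\<lambda>_ y. y\<^sup>2"])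
      (use G in \<open>auto simp: lebd_def intro: nn_integral_lborel_square_abs\<close>)
  show "(\<integral>\<^sup>+y. (\<Prod>i<d. ennreal (2 * y i)) * G (psi d y) \<partial>lebd d) = (\<integral>\<^sup>+u. (\<Prod>i<d. indicator {0..} (u i)) * G u \<partial>lebd d)"
    unfolding lebd_def psi_def
    by (rule nn_integral_PiM_lborel_substitution[where w = "\<lambda>_ y. ennreal (2 * y)" and v = "\<lambda>_. indicator {0..}" and T = "\<lambda>_ y. y\<^sup>2"])
      (use G in \<open>auto simp: lebd_def intro: nn_integral_lborel_square\<close>)
qed

text \<open>The conventions for degenerate quotients agree with the claim: N' = 0 forces N = 0, D' =
  0 with N' nonzero makes the right side infinite, and D' infinite forces D infinite and the left
  side 0.\<close>

lemma ennreal_quotient_le: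
  fixes N D N' D' :: ennreal
  assumes "0 < \<alpha>" "0 < \<beta>" and N: "N \<le> ennreal \<alpha> * N'" and D: "ennreal \<beta> * D' \<le> D"
  shows "N / D \<le> ennreal (\<alpha> / \<beta>) * (N' / D')"
proof (cases "N' = 0 \<or> D' = 0 \<or> D' = top")
  case True
  have "N / D = 0" if "N' = 0" using N that by simp
  moreover have "ennreal (\<alpha> / \<beta>) * (N' / D') = top" if "N' \<noteq> 0" "D' = 0"
    using that assms(1,2) by (simp add: ennreal_mult_eq_top_iff)
  moreover have "N / D = 0" if "D' = top"
    using that D assms(2) by (simp add: ennreal_mult_top top_unique)
  ultimately show ?thesis using True by (metis top_greatest zero_le)
next
  case False
  then have "0 < D" using D assms(2) by (metis ennreal_eq_0_iff le_zero_eq mult_eq_0_iff not_gr_zero not_le)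
  moreover have "N \<le> ennreal (\<alpha> / \<beta>) * (N' / D') * D"
  proof -
    have "ennreal \<alpha> * N' = ennreal (\<alpha> / \<beta>) * (N' / D') * (ennreal \<beta> * D')"
    proof -
      have "ennreal (\<alpha> / \<beta>) * ennreal \<beta> = ennreal \<alpha>"
        using assms(1,2) by (simp add: ennreal_mult'[symmetric])
      moreover have "N' / D' * D' = N'"
        using False by (simp add: ennreal_divide_times ennreal_divide_self less_top)
      ultimately show ?thesis by (metis mult.assoc mult.commute)
    qed
    also have "\<dots> \<le> ennreal (\<alpha> / \<beta>) * (N' / D') * D"
      by (intro mult_left_mono D) simp
    finally show ?thesis using N by simp
  qed
  ultimately show ?thesis by (intro divide_le_posI_ennreal) (simp_all add: mult.commute)
qed

lemma sum_liftY_squares: "y \<in> ballB d \<Longrightarrow> (\<Sum>i\<le>d. (liftY d y i)\<^sup>2) = 1"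
  by (simp add: lessThan_Suc_atMost[symmetric] liftY_def ballB_def)

text \<open>The bound of \<open>Vk_cap_upper\<close> depends on z only through the |z_i|, which the
  reflection of the last coordinate preserves.\<close>

lemma VkB_cap_upper:
  fixes d :: nat
  assumes \<kappa>: "\<forall>i\<le>d. 0 \<le> \<kappa> i"
  obtains C where "0 < C" and "\<And>x \<theta> y. x \<in> simplexT d \<Longrightarrow> 0 < \<theta> \<Longrightarrow> y \<in> ballB d \<Longrightarrow>
    VkB \<kappa> d (indicator (capE d (\<lambda>i\<in>{..<d}. sqrt (x i)) \<theta>)) (liftY d y)
    \<le> C * capK \<kappa> d x \<theta> * indicator (capT d x (cos \<theta>)) (psi d y)"
proof -
  obtain C where C: "0 < C" "\<And>x \<theta> z. x \<in> simplexT d \<Longrightarrow> 0 < \<theta> \<Longrightarrow> (\<Sum>i\<le>d. (z i)\<^sup>2) = 1 \<Longrightarrow>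
    Vk \<kappa> d (indicator (capE d (\<lambda>i\<in>{..<d}. sqrt (x i)) \<theta>)) z
    \<le> C * capK \<kappa> d x \<theta> * (if cos \<theta> \<le> (\<Sum>i\<le>d. octant d x i * \<bar>z i\<bar>) then 1 else 0)"
    by (rule Vk_cap_upper[OF \<kappa>]) blast
  have "VkB \<kappa> d (indicator (capE d (\<lambda>i\<in>{..<d}. sqrt (x i)) \<theta>)) (liftY d y)
      \<le> C * capK \<kappa> d x \<theta> * indicator (capT d x (cos \<theta>)) (psi d y)"
    if x: "x \<in> simplexT d" and \<theta>: "0 < \<theta>" and y: "y \<in> ballB d" for x \<theta> y
  proof -
    have psi: "psi d y \<in> simplexT d"
      using y ballB_iff_psi[of y d] by (simp add: ballB_def space_lebd)
    have le: "Vk \<kappa> d (indicator (capE d (\<lambda>i\<in>{..<d}. sqrt (x i)) \<theta>)) z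
        \<le> C * capK \<kappa> d x \<theta> * indicator (capT d x (cos \<theta>)) (psi d y)"
      if z: "\<And>i. \<bar>z i\<bar> = \<bar>liftY d y i\<bar>" for z
    proof -
      have "(\<Sum>i\<le>d. (z i)\<^sup>2) = (\<Sum>i\<le>d. (liftY d y i)\<^sup>2)"
        by (intro sum.cong refl) (metis power2_abs z)
      then have "Vk \<kappa> d (indicator (capE d (\<lambda>i\<in>{..<d}. sqrt (x i)) \<theta>)) z
          \<le> C * capK \<kappa> d x \<theta> * (if cos \<theta> \<le> (\<Sum>i\<le>d. octant d x i * \<bar>z i\<bar>) then 1 else 0)"
        using sum_liftY_squares[OF y] by (intro C(2) x \<theta>) simp
      also have "(\<Sum>i\<le>d. octant d x i * \<bar>z i\<bar>) = (\<Sum>i\<le>d. octant d x i * octant d (psi d y) i)"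
        using octant_psi[OF y] z by (intro sum.cong) auto
      also have "(if cos \<theta> \<le> (\<Sum>i\<le>d. octant d x i * octant d (psi d y) i) then 1 else 0 :: real)
          = indicator (capT d x (cos \<theta>)) (psi d y)"
        using psi by (simp add: capT_def)
      finally show ?thesis .
    qed
    have "Vk \<kappa> d (indicator (capE d (\<lambda>i\<in>{..<d}. sqrt (x i)) \<theta>)) (liftY d y)
        \<le> C * capK \<kappa> d x \<theta> * indicator (capT d x (cos \<theta>)) (psi d y)"
      "Vk \<kappa> d (indicator (capE d (\<lambda>i\<in>{..<d}. sqrt (x i)) \<theta>)) ((liftY d y)(d := - liftY d y d))
        \<le> C * capK \<kappa> d x \<theta> * indicator (capT d x (cos \<theta>)) (psi d y)"
      by (rule le; simp)+
    moreover have "(v + v') / 2 \<le> b" if "v \<le> b" "v' \<le> b" for v v' b :: real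
      using that by (simp add: field_simps)
    ultimately show ?thesis unfolding VkB_def by blast
  qed
  with C(1) show ?thesis by (rule that)
qed

text \<open>The reflected term is dropped as nonnegative, which costs a factor 2.\<close>

lemma VkB_cap_lower:
  fixes d :: nat
  assumes \<kappa>: "\<forall>i\<le>d. 0 \<le> \<kappa> i"
  obtains c where "0 < c" and "\<And>x \<theta> y. x \<in> simplexT d \<Longrightarrow> 0 < \<theta> \<Longrightarrow> y \<in> ballB d \<Longrightarrow>
    (\<And>i. i < d \<Longrightarrow> 0 \<le> y i) \<Longrightarrow> psi d y \<in> capT d x (cos \<theta> + \<theta>\<^sup>2 / 50) \<Longrightarrow>
    c * capK \<kappa> d x \<theta> \<le> VkB \<kappa> d (indicator (capE d (\<lambda>i\<in>{..<d}. sqrt (x i)) \<theta>)) (liftY d y)"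
proof -
  obtain c where c: "0 < c" "\<And>x \<theta> z. x \<in> simplexT d \<Longrightarrow> 0 < \<theta> \<Longrightarrow> (\<Sum>i\<le>d. (z i)\<^sup>2) = 1 \<Longrightarrow>
    (\<And>i. i \<le> d \<Longrightarrow> 0 \<le> z i) \<Longrightarrow> cos \<theta> + \<theta>\<^sup>2 / 50 \<le> (\<Sum>i\<le>d. octant d x i * z i) \<Longrightarrow>
    c * capK \<kappa> d x \<theta> \<le> Vk \<kappa> d (indicator (capE d (\<lambda>i\<in>{..<d}. sqrt (x i)) \<theta>)) z"
    by (rule Vk_cap_lower[OF \<kappa>]) blast
  have "c / 2 * capK \<kappa> d x \<theta> \<le> VkB \<kappa> d (indicator (capE d (\<lambda>i\<in>{..<d}. sqrt (x i)) \<theta>)) (liftY d y)"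
    if x: "x \<in> simplexT d" and \<theta>: "0 < \<theta>" and y: "y \<in> ballB d" "\<And>i. i < d \<Longrightarrow> 0 \<le> y i"
      and cap: "psi d y \<in> capT d x (cos \<theta> + \<theta>\<^sup>2 / 50)" for x \<theta> y
  proof -
    have nn: "0 \<le> liftY d y i" if "i \<le> d" for i
      using y that by (auto simp: liftY_def ballB_def)
    have "(\<Sum>i\<le>d. octant d x i * liftY d y i) = (\<Sum>i\<le>d. octant d x i * octant d (psi d y) i)"
      using octant_psi[OF y(1)] nn by (intro sum.cong) auto
    then have "c * capK \<kappa> d x \<theta> \<le> Vk \<kappa> d (indicator (capE d (\<lambda>i\<in>{..<d}. sqrt (x i)) \<theta>)) (liftY d y)"
      using cap by (intro c(2) x \<theta> sum_liftY_squares y(1) nn) (auto simp: capT_def)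
    moreover have "0 \<le> Vk \<kappa> d (indicator (capE d (\<lambda>i\<in>{..<d}. sqrt (x i)) \<theta>)) ((liftY d y)(d := - liftY d y d))"
      unfolding Vk_def by (rule Bochner_Integration.integral_nonneg) simp
    ultimately show ?thesis by (simp add: VkB_def)
  qed
  with c(1) show ?thesis by (intro that[of "c / 2"]) auto
qed

theorem theorem5p3:
  fixes d :: nat and \<kappa> :: "nat \<Rightarrow> real"
  assumes "1 \<le> d" and "\<forall>i\<le>d. 0 \<le> \<kappa> i"
  shows "\<exists>c::real. \<forall>f x. f \<in> borel_measurable (lebd d)
           \<and> (\<integral>\<^sup>+ y\<in>simplexT d. ennreal (\<bar>f y\<bar> * WT \<kappa> d y) \<partial>lebd d) < \<infinity>
           \<and> x \<in> simplexT d
           \<longrightarrow> MT \<kappa> d f x \<le> ennreal c * MTd \<kappa> d f x"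
proof -
  obtain C where C: "0 < C" "\<And>x \<theta> y. x \<in> simplexT d \<Longrightarrow> 0 < \<theta> \<Longrightarrow> y \<in> ballB d \<Longrightarrow>
    VkB \<kappa> d (indicator (capE d (\<lambda>i\<in>{..<d}. sqrt (x i)) \<theta>)) (liftY d y)
    \<le> C * capK \<kappa> d x \<theta> * indicator (capT d x (cos \<theta>)) (psi d y)"
    by (rule VkB_cap_upper[OF assms(2)]) blast
  obtain c where c: "0 < c" "\<And>x \<theta> y. x \<in> simplexT d \<Longrightarrow> 0 < \<theta> \<Longrightarrow> y \<in> ballB d \<Longrightarrow>
    (\<And>i. i < d \<Longrightarrow> 0 \<le> y i) \<Longrightarrow> psi d y \<in> capT d x (cos \<theta> + \<theta>\<^sup>2 / 50) \<Longrightarrow>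
    c * capK \<kappa> d x \<theta> \<le> VkB \<kappa> d (indicator (capE d (\<lambda>i\<in>{..<d}. sqrt (x i)) \<theta>)) (liftY d y)"
    by (rule VkB_cap_lower[OF assms(2)]) blast
  obtain B where B: "0 < B" "\<And>x \<theta>. x \<in> simplexT d \<Longrightarrow> 0 < \<theta> \<Longrightarrow> \<theta> \<le> pi \<Longrightarrow>
      (\<integral>\<^sup>+u\<in>capT d x (cos \<theta>). ennreal (WT \<kappa> d u) \<partial>lebd d)
    \<le> ennreal B * (\<integral>\<^sup>+u\<in>capT d x (cos \<theta> + \<theta>\<^sup>2 / 50). ennreal (WT \<kappa> d u) \<partial>lebd d)"
    by (rule capT_doubling[of d \<kappa>]) (use assms in blast)+
  \<comment> \<open>In the lower bound the Jacobian contributes 2 y_i per coordinate while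
    \<open>WB\<close> supplies only |y_i|.\<close>
  define c' where "c' = c / 2 ^ d"
  have c': "0 < c'" using c(1) by (simp add: c'_def)
  have "MT \<kappa> d f x \<le> ennreal (C * B / c') * MTd \<kappa> d f x"
    if f[measurable]: "f \<in> borel_measurable (lebd d)" and x: "x \<in> simplexT d" for f x
  proof -
    define V where "V \<theta> y = VkB \<kappa> d (indicator (capE d (\<lambda>i\<in>{..<d}. sqrt (x i)) \<theta>)) (liftY d y)" for \<theta> y
    define S where "S \<tau> = capT d x \<tau>" for \<tau>
    have [measurable]: "S \<tau> \<in> sets (lebd d)" for \<tau> by (simp add: S_def)
    have quotient: "(\<integral>\<^sup>+y\<in>ballB d. ennreal (\<bar>(f \<circ> psi d) y\<bar> * V \<theta> y * WB \<kappa> d y) \<partial>lebd d)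
        / (\<integral>\<^sup>+y\<in>ballB d. ennreal (V \<theta> y * WB \<kappa> d y) \<partial>lebd d)
      \<le> ennreal (C * B / c') * ((\<integral>\<^sup>+u\<in>S (cos \<theta>). ennreal (\<bar>f u\<bar> * WT \<kappa> d u) \<partial>lebd d)
        / (\<integral>\<^sup>+u\<in>S (cos \<theta>). ennreal (WT \<kappa> d u) \<partial>lebd d))"
      if \<theta>: "0 < \<theta>" "\<theta> \<le> pi" for \<theta>
    proof -
      define K where "K = capK \<kappa> d x \<theta>"
      have K: "0 < K" using x \<theta>(1) by (simp add: K_def capK_pos)
      have upper: "(\<integral>\<^sup>+y\<in>ballB d. ennreal (\<bar>(f \<circ> psi d) y\<bar> * V \<theta> y * WB \<kappa> d y) \<partial>lebd d)
        \<le> ennreal (C * K) * (\<integral>\<^sup>+u\<in>S (cos \<theta>). ennreal (\<bar>f u\<bar> * WT \<kappa> d u) \<partial>lebd d)"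
      proof -
        define G where "G u = ennreal (C * K) * (ennreal (\<bar>f u\<bar> * WT \<kappa> d u) * indicator (S (cos \<theta>)) u)" for u
        have [measurable]: "G \<in> borel_measurable (lebd d)" unfolding G_def by measurable
        have "(\<integral>\<^sup>+y\<in>ballB d. ennreal (\<bar>(f \<circ> psi d) y\<bar> * V \<theta> y * WB \<kappa> d y) \<partial>lebd d)
          \<le> (\<integral>\<^sup>+y. (\<Prod>i<d. ennreal \<bar>y i\<bar>) * G (psi d y) \<partial>lebd d)"
        \<comment> \<open>Monotonicity of \<open>nn_integral\<close> holds for arbitrary functions,
          so measurability of V in y does not enter; only the majorant has to be measurable.\<close>
        proof (rule nn_integral_mono)
          fix y
          show "ennreal (\<bar>(f \<circ> psi d) y\<bar> * V \<theta> y * WB \<kappa> d y) * indicator (ballB d) y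
            \<le> (\<Prod>i<d. ennreal \<bar>y i\<bar>) * G (psi d y)"
          proof (cases "y \<in> ballB d")
            case True
            define w where "w = \<bar>f (psi d y)\<bar> * WT \<kappa> d (psi d y)"
            define p where "p = (\<Prod>i<d. \<bar>y i\<bar>)"
            have w: "0 \<le> w" and p: "0 \<le> p"
              by (auto simp: w_def p_def WT_nonneg prod_nonneg)
            have "V \<theta> y * (w * p) \<le> C * K * indicator (S (cos \<theta>)) (psi d y) * (w * p)"
              using C(2)[OF x \<theta>(1) True] w p unfolding V_def K_def S_def
              by (intro mult_right_mono) auto
            then have "ennreal (\<bar>(f \<circ> psi d) y\<bar> * V \<theta> y * WB \<kappa> d y)
              \<le> ennreal (p * (C * K * (w * indicator (S (cos \<theta>)) (psi d y))))"
              by (intro ennreal_leI) (simp add: w_def p_def WB_eq_WT_psi mult_ac)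
            also have "\<dots> = ennreal p * G (psi d y)"
              using w p C(1) K by (simp add: G_def w_def[symmetric] ennreal_mult ennreal_indicator[symmetric] del: ennreal_indicator)
            also have "ennreal p = (\<Prod>i<d. ennreal \<bar>y i\<bar>)"
              unfolding p_def by (rule prod_ennreal[symmetric]) simp
            finally show ?thesis using True by simp
          qed simp
        qed
        also have "\<dots> = (\<integral>\<^sup>+u. (\<Prod>i<d. indicator {0..} (u i)) * G u \<partial>lebd d)"
          by (rule nn_integral_lebd_psi) simp
        also have "\<dots> \<le> (\<integral>\<^sup>+u. 1 * G u \<partial>lebd d)"
        proof (intro nn_integral_mono mult_right_mono)
          fix u :: "nat \<Rightarrow> real"
          have "(\<Prod>i<d. indicator {0..} (u i)) \<le> (\<Prod>i<d. 1 :: ennreal)"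
            by (rule prod_mono_ennreal) (auto split: split_indicator)
          then show "(\<Prod>i<d. indicator {0..} (u i)) \<le> (1 :: ennreal)" by simp
        qed simp
        also have "\<dots> = ennreal (C * K) * (\<integral>\<^sup>+u\<in>S (cos \<theta>). ennreal (\<bar>f u\<bar> * WT \<kappa> d u) \<partial>lebd d)"
          unfolding G_def mult_1 by (rule nn_integral_cmult) measurable
        finally show ?thesis .
      qed
      have lower: "ennreal (c' * K / B) * (\<integral>\<^sup>+u\<in>S (cos \<theta>). ennreal (WT \<kappa> d u) \<partial>lebd d)
        \<le> (\<integral>\<^sup>+y\<in>ballB d. ennreal (V \<theta> y * WB \<kappa> d y) \<partial>lebd d)"
      proof -
        define T where "T = S (cos \<theta> + \<theta>\<^sup>2 / 50)"
        have [measurable]: "T \<in> sets (lebd d)" by (simp add: T_def)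
        have T: "u \<in> simplexT d" if "u \<in> T" for u
          using that by (simp add: T_def S_def capT_def)
        define G where "G u = ennreal (c' * K) * (ennreal (WT \<kappa> d u) * indicator T u)" for u
        have [measurable]: "G \<in> borel_measurable (lebd d)" unfolding G_def by measurable
        have "ennreal (c' * K / B) * (\<integral>\<^sup>+u\<in>S (cos \<theta>). ennreal (WT \<kappa> d u) \<partial>lebd d)
          \<le> ennreal (c' * K / B) * (ennreal B * (\<integral>\<^sup>+u\<in>T. ennreal (WT \<kappa> d u) \<partial>lebd d))"
          unfolding T_def S_def by (intro mult_left_mono B(2) x \<theta>) simp
        also have "\<dots> = ennreal (c' * K) * (\<integral>\<^sup>+u\<in>T. ennreal (WT \<kappa> d u) \<partial>lebd d)"
          using B(1) c' K by (simp add: mult.assoc[symmetric] ennreal_mult'[symmetric])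
        also have "\<dots> = (\<integral>\<^sup>+u. G u \<partial>lebd d)"
          unfolding G_def by (rule nn_integral_cmult[symmetric]) measurable
        \<comment> \<open>The support T of G lies in the simplex, so the indicators of nonnegative
          coordinates cost nothing.\<close>
        also have "\<dots> = (\<integral>\<^sup>+u. (\<Prod>i<d. indicator {0..} (u i)) * G u \<partial>lebd d)"
        proof (rule nn_integral_cong)
          fix u :: "nat \<Rightarrow> real"
          show "G u = (\<Prod>i<d. indicator {0..} (u i)) * G u"
          proof (cases "u \<in> T")
            case True
            then have "(\<Prod>i<d. indicator {0..} (u i)) = (1 :: ennreal)"
              using T[OF True] by (intro prod.neutral) (auto simp: simplexT_def)
            then show ?thesis by simp
          qed (simp add: G_def)
        qed
        also have "\<dots> = (\<integral>\<^sup>+y. (\<Prod>i<d. ennreal (2 * y i)) * G (psi d y) \<partial>lebd d)"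
          by (rule nn_integral_lebd_psi(2)[symmetric]) simp
        also have "\<dots> \<le> (\<integral>\<^sup>+y\<in>ballB d. ennreal (V \<theta> y * WB \<kappa> d y) \<partial>lebd d)"
        proof (rule nn_integral_mono)
          fix y assume "y \<in> space (lebd d)"
          show "(\<Prod>i<d. ennreal (2 * y i)) * G (psi d y) \<le> ennreal (V \<theta> y * WB \<kappa> d y) * indicator (ballB d) y"
          proof (cases "(\<forall>i<d. 0 \<le> y i) \<and> psi d y \<in> T")
            case True
            then have y: "y \<in> ballB d"
              using ballB_iff_psi[OF \<open>y \<in> space (lebd d)\<close>] T by blast
            define w where "w = WT \<kappa> d (psi d y)"
            define p where "p = (\<Prod>i<d. \<bar>y i\<bar>)"
            have w: "0 \<le> w" and p: "0 \<le> p"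
              by (auto simp: w_def p_def WT_nonneg prod_nonneg)
            have "(\<Prod>i<d. ennreal (2 * y i)) = ennreal (\<Prod>i<d. 2 * y i)"
              using True by (intro prod_ennreal) auto
            also have "(\<Prod>i<d. 2 * y i) = (\<Prod>i<d. 2 * \<bar>y i\<bar>)"
              using True by (intro prod.cong) auto
            also have "\<dots> = 2 ^ d * p"
              by (simp add: p_def prod.distrib)
            finally have "(\<Prod>i<d. ennreal (2 * y i)) * G (psi d y) = ennreal (2 ^ d * p) * (ennreal (c' * K) * ennreal w)"
              using True by (simp add: G_def w_def)
            also have "\<dots> = ennreal (c * K * (w * p))"
              using w p c' K by (simp add: ennreal_mult'[symmetric] c'_def mult_ac)
            also have "\<dots> \<le> ennreal (V \<theta> y * (w * p))"
            proof (intro ennreal_leI mult_right_mono)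
              show "c * K \<le> V \<theta> y"
                unfolding K_def V_def using True by (intro c(2) x \<theta> y) (auto simp: T_def S_def)
            qed (use w p in simp)
            also have "V \<theta> y * (w * p) = V \<theta> y * WB \<kappa> d y"
              by (simp add: w_def p_def WB_eq_WT_psi)
            finally show ?thesis using y by simp
          next
            case False
            \<comment> \<open>Either the point lies outside T, or a negative y_i makes its truncated
              Jacobian factor 0.\<close>
            have 0: "(\<Prod>i<d. ennreal (2 * y i)) * G (psi d y) = 0"
            proof (cases "psi d y \<in> T")
              case True
              then obtain i where "i < d" "y i < 0" using False by (auto simp: not_le)
              then have "(\<Prod>i<d. ennreal (2 * y i)) = 0"
                by (intro prod_zero bexI[of _ i]) (auto simp: ennreal_neg)
              then show ?thesis by simp
            qed (simp add: G_def)
            show ?thesis unfolding 0 by simp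
          qed
        qed
        finally show ?thesis .
      qed
      \<comment> \<open>K depends on x and \<theta> and disappears here, leaving a constant uniform
        in both.\<close>
      have "C * K / (c' * K / B) = C * B / c'"
        using K c' B(1) by (simp add: field_simps)
      then show ?thesis
        using ennreal_quotient_le[OF _ _ upper lower] C(1) K c' B(1) by simp
    qed
    show ?thesis
      unfolding MT_def MB_def
    proof (rule SUP_least)
      fix \<theta> assume "\<theta> \<in> {0<..pi}"
      then have \<theta>: "0 < \<theta>" "\<theta> \<le> pi" by auto
      note quotient[OF \<theta>]
      also have "(\<integral>\<^sup>+u\<in>S (cos \<theta>). ennreal (\<bar>f u\<bar> * WT \<kappa> d u) \<partial>lebd d)
        / (\<integral>\<^sup>+u\<in>S (cos \<theta>). ennreal (WT \<kappa> d u) \<partial>lebd d) \<le> MTd \<kappa> d f x"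
        unfolding MTd_def
        by (rule SUP_upper2[of \<theta>]) (use \<theta> dT_le_iff_capT[OF x, of \<theta>] in \<open>auto simp: S_def\<close>)
      then have "ennreal (C * B / c') * ((\<integral>\<^sup>+u\<in>S (cos \<theta>). ennreal (\<bar>f u\<bar> * WT \<kappa> d u) \<partial>lebd d)
        / (\<integral>\<^sup>+u\<in>S (cos \<theta>). ennreal (WT \<kappa> d u) \<partial>lebd d)) \<le> ennreal (C * B / c') * MTd \<kappa> d f x"
        by (rule mult_left_mono) simp
      finally show "(\<integral>\<^sup>+y\<in>ballB d. ennreal (\<bar>(f \<circ> psi d) y\<bar> *
            VkB \<kappa> d (indicator (capE d (\<lambda>i\<in>{..<d}. sqrt (x i)) \<theta>)) (liftY d y) * WB \<kappa> d y) \<partial>lebd d)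
          / (\<integral>\<^sup>+y\<in>ballB d. ennreal (VkB \<kappa> d (indicator (capE d (\<lambda>i\<in>{..<d}. sqrt (x i)) \<theta>)) (liftY d y) * WB \<kappa> d y) \<partial>lebd d)
        \<le> ennreal (C * B / c') * MTd \<kappa> d f x"
        unfolding V_def .
    qed
  qed
  then show ?thesis by blast
qed

end
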